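(* (i) If $G$ is a simple graph with $q$ edges, then $\theta_{\mathrm{int}}(G)\leq \left\lceil\sqrt{q/2}\right\rceil$. (ii) If $G$ is a simple planar graph, then $\theta_{\mathrm{int}}(G)\leq 3$. If, additionally, $G$ is triangle-free or outerplanar, then $\theta_{\mathrm{int}}(G)\leq 2$.
   Context: Graphs are finite and undirected; a simple graph has no loops and no multiple edges. An interval $t$-coloring of a graph is a proper edge coloring (adjacent edges receive different colors) with colors $1,2,\dots,t$ such that for every vertex the colors of the edges incident to it form an interval of integers. A graph is interval colorable if it has an interval $t$-coloring for some integer $t$. A decomposition of $G$ into $k$ interval colorable subgraphs is a list of $k$ interval colorable subgraphs of $G$ such that every edge of $G$ appears in exactly one subgraph in the list. The interval coloring thickness $\theta_{\mathrm{int}}(G)$ is the minimum positive integer $k$ such that $G$ has a decomposition into $k$ interval colorable subgraphs.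
   Formalization: Part (i) is stated for graphs with at least one edge (q ≥ 1): for q = 0 the bound is 0, whereas the thickness, being a positive integer, equals 1, so the claim fails there. *)

theory Defs
  imports "HOL-Analysis.Analysis"
begin

record 'a ugraph =
  verts :: "'a set"
  edges :: "'a set set"

definition simple_graph :: "'a ugraph \<Rightarrow> bool" where
  "simple_graph G \<longleftrightarrow>
     finite (verts G) \<and> (\<forall>e\<in>edges G. e \<subseteq> verts G \<and> card e = 2)"

definition subgraph :: "'a ugraph \<Rightarrow> 'a ugraph \<Rightarrow> bool" where
  "subgraph H G \<longleftrightarrow>
     simple_graph H \<and> verts H \<subseteq> verts G \<and> edges H \<subseteq> edges G"

definition incident_edges :: "'a ugraph \<Rightarrow> 'a \<Rightarrow> 'a set set" where
  "incident_edges G v = {e \<in> edges G. v \<in> e}"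

definition proper_edge_coloring :: "'a ugraph \<Rightarrow> ('a set \<Rightarrow> nat) \<Rightarrow> bool" where
  "proper_edge_coloring G c \<longleftrightarrow>
     (\<forall>e\<in>edges G. \<forall>f\<in>edges G. e \<noteq> f \<and> e \<inter> f \<noteq> {} \<longrightarrow> c e \<noteq> c f)"

text \<open>The interval \<open>{a..b}\<close> may be empty, so isolated vertices impose no condition.
  Not every colour in \<open>{1..t}\<close> has to be used; interval colourability is the same under
  either convention.\<close>

definition interval_coloring :: "'a ugraph \<Rightarrow> nat \<Rightarrow> ('a set \<Rightarrow> nat) \<Rightarrow> bool" where
  "interval_coloring G t c \<longleftrightarrow>
     proper_edge_coloring G c \<and>
     (\<forall>e\<in>edges G. c e \<in> {1..t}) \<and>
     (\<forall>v\<in>verts G. \<exists>a b. c ` incident_edges G v = {a..b})"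

definition interval_colorable :: "'a ugraph \<Rightarrow> bool" where
  "interval_colorable G \<longleftrightarrow> (\<exists>t c. interval_coloring G t c)"

definition interval_decomposition :: "'a ugraph \<Rightarrow> 'a ugraph list \<Rightarrow> bool" where
  "interval_decomposition G Hs \<longleftrightarrow>
     (\<forall>H\<in>set Hs. subgraph H G \<and> interval_colorable H) \<and>
     (\<forall>e\<in>edges G. \<exists>!i. i < length Hs \<and> e \<in> edges (Hs ! i))"

text \<open>For a simple graph the minimum is over a nonempty set, since a graph with at most one
  edge is interval colourable.\<close>

definition interval_thickness :: "'a ugraph \<Rightarrow> nat" where
  "interval_thickness G =
     (LEAST k. 0 < k \<and> (\<exists>Hs. length Hs = k \<and> interval_decomposition G Hs))"

definition triangle_free :: "'a ugraph \<Rightarrow> bool" where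
  "triangle_free G \<longleftrightarrow>
     \<not> (\<exists>u v w. u \<noteq> v \<and> v \<noteq> w \<and> u \<noteq> w \<and>
           {u, v} \<in> edges G \<and> {v, w} \<in> edges G \<and> {u, w} \<in> edges G)"

text \<open>A drawing in the plane without crossings: vertices are distinct points, edges are
  arcs (injective paths) joining their end vertices, an edge passes through no other vertex,
  and two edges meet only at common end vertices.\<close>

definition plane_drawing ::
  "'a ugraph \<Rightarrow> ('a \<Rightarrow> complex) \<Rightarrow> ('a set \<Rightarrow> real \<Rightarrow> complex) \<Rightarrow> bool" where
  "plane_drawing G p \<gamma> \<longleftrightarrow>
     inj_on p (verts G) \<and>
     (\<forall>e\<in>edges G. arc (\<gamma> e) \<and> {pathstart (\<gamma> e), pathfinish (\<gamma> e)} = p ` e) \<and>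
     (\<forall>e\<in>edges G. \<forall>v\<in>verts G. p v \<in> path_image (\<gamma> e) \<longrightarrow> v \<in> e) \<and>
     (\<forall>e\<in>edges G. \<forall>f\<in>edges G. e \<noteq> f \<longrightarrow>
        path_image (\<gamma> e) \<inter> path_image (\<gamma> f) \<subseteq> p ` (e \<inter> f))"

definition drawing_points ::
  "'a ugraph \<Rightarrow> ('a \<Rightarrow> complex) \<Rightarrow> ('a set \<Rightarrow> real \<Rightarrow> complex) \<Rightarrow> complex set" where
  "drawing_points G p \<gamma> = p ` verts G \<union> (\<Union>e\<in>edges G. path_image (\<gamma> e))"

definition planar :: "'a ugraph \<Rightarrow> bool" where
  "planar G \<longleftrightarrow> (\<exists>p \<gamma>. plane_drawing G p \<gamma>)"

text \<open>The complement of a drawing has exactly one unbounded component, the outer face, so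
  \<^const>\<open>outside\<close> of the drawing is the outer face.\<close>

definition outerplanar :: "'a ugraph \<Rightarrow> bool" where
  "outerplanar G \<longleftrightarrow>
     (\<exists>p \<gamma>. plane_drawing G p \<gamma> \<and>
        (\<forall>v\<in>verts G. p v \<in> frontier (outside (drawing_points G p \<gamma>))))"

end

theory Submission
  imports Defs
begin

text \<open>
  A forest is interval colorable: build it by attaching leaves, and give each new edge the color
  just above those already used at its old end. So a graph that splits into \<open>k\<close> forests has
  thickness at most \<open>k\<close> (lemma \<open>interval_thickness_le_density\<close>), and all three bounds are bounds on
  arboricity. By the theorem of Nash-Williams (\<open>nash_williams\<close>) it suffices that every nonempty set
  \<open>U\<close> of vertices spans at most \<open>k * (card U - 1)\<close> edges.

  For \<open>q\<close> edges take \<open>k\<close> to be the ceiling of \<open>sqrt (q / 2)\<close>, so \<open>q \<le> 2 * k\<^sup>2\<close>. A set of at most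
  \<open>2 * k\<close> vertices is sparse enough because it spans at most \<open>card U * (card U - 1) / 2\<close> edges, and a
  larger one because \<open>q \<le> k * (2 * k)\<close>.

  In the planar cases the count comes from Euler's formula; subgraphs inherit the drawing, so it is
  enough to bound the edges of the whole graph. Only two inequalities about the faces of a drawing
  with \<open>n\<close> vertices and \<open>m\<close> edges are used. There are at least \<open>m - n + 2\<close> faces (\<open>many_faces\<close>): draw
  the edges one by one; an edge whose ends are already joined completes a Jordan curve, so it
  cuts a face in two. And every edge borders at most two faces (\<open>edge_borders_at_most_two\<close>),
  since adding an arc cuts a region of the plane into at most two pieces. Unless the graph is a
  forest, the edges bordering a face contain a cycle, since drawn forests do not separate the
  plane (\<open>border_contains_cycle\<close>). So each face has at least 3 border edges, or 4 if there are
  no triangles, and double counting gives \<open>m \<le> 3 * n - 6\<close> and \<open>m \<le> 2 * n - 4\<close>.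

  In an outerplanar graph with all degrees at least 3, every vertex has two border edges of the
  outer face (\<open>two_border_edges_at_vertex\<close>). The outer face thus has at least \<open>n\<close> border edges, which
  improves the count to \<open>m \<le> 2 * n - 3\<close>. A vertex of degree at most 2 is removed by induction.
\<close>

section \<open>Covering by independent sets\<close>

text \<open>The covering theorem for matroids, in Welsh's form of Rado's argument. Every element \<open>e\<close> starts
  with the full list \<open>A e\<close> of \<open>k\<close> colors; lists are shrunk as long as every \<open>J\<close> satisfies
  \<open>card J \<le> (\<Sum>i<k. r {e \<in> J. i \<in> A e})\<close>. If \<open>x\<close> and \<open>y\<close> are two colors in one list, submodularity
  forbids that removing \<open>x\<close> and removing \<open>y\<close> both break the condition, so in the end all lists are
  singletons.\<close>

lemma submodular_cover:
  fixes r :: "'e set \<Rightarrow> nat"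
  assumes fin: "finite E"
    and r_empty: "r {} = 0"
    and mono: "\<And>A B. A \<subseteq> B \<Longrightarrow> B \<subseteq> E \<Longrightarrow> r A \<le> r B"
    and submod: "\<And>A B. A \<subseteq> E \<Longrightarrow> B \<subseteq> E \<Longrightarrow> r (A \<union> B) + r (A \<inter> B) \<le> r A + r B"
    and dens: "\<And>J. J \<subseteq> E \<Longrightarrow> card J \<le> k * r J"
  obtains c where "\<forall>e\<in>E. c e < k"
    and "\<And>i J. i < k \<Longrightarrow> J \<subseteq> {e\<in>E. c e = i} \<Longrightarrow> card J \<le> r J"
proof -
  define R where "R A J = (\<Sum>i<k. r {e\<in>J. i \<in> A e})" for A :: "'e \<Rightarrow> nat set" and J
  define good where "good A \<longleftrightarrow> (\<forall>e\<in>E. A e \<subseteq> {..<k}) \<and> (\<forall>J\<subseteq>E. card J \<le> R A J)" for A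
  have "good (\<lambda>_. {..<k})"
    using dens by (auto simp: good_def R_def)
  then obtain A where good: "good A"
    and least: "\<And>A'. good A' \<Longrightarrow> (\<Sum>e\<in>E. card (A e)) \<le> (\<Sum>e\<in>E. card (A' e))"
    using ex_has_least_nat[of good "\<lambda>_. {..<k}" "\<lambda>A. \<Sum>e\<in>E. card (A e)"] by blast
  have sub: "A e \<subseteq> {..<k}" if "e \<in> E" for e using good that by (auto simp: good_def)
  have finA: "finite (A e)" if "e \<in> E" for e using sub[OF that] finite_subset by blast
  have cond: "card J \<le> R A J" if "J \<subseteq> E" for J using good that by (auto simp: good_def)
  \<comment> \<open>By minimality every further shrinking breaks the condition, at a set that contains \<open>e\<close>.\<close>
  have violated: "\<exists>J\<subseteq>E. e \<in> J \<and> R (A(e := A e - {x})) J < card J"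
    if "e \<in> E" "x \<in> A e" for e x
  proof -
    let ?A = "A(e := A e - {x})"
    have "(\<Sum>f\<in>E. card (?A f)) < (\<Sum>f\<in>E. card (A f))"
    proof (rule sum_strict_mono_ex1[OF fin])
      show "\<forall>f\<in>E. card (?A f) \<le> card (A f)" by (auto intro: card_mono finA)
      show "\<exists>f\<in>E. card (?A f) < card (A f)"
        using that finA by (intro bexI[of _ e]) (auto intro!: card_Diff1_less simp del: card_Diff_insert)
    qed
    then have "\<not> good ?A" using least not_le by blast
    moreover have "\<forall>f\<in>E. ?A f \<subseteq> {..<k}" using sub by auto
    ultimately obtain J where J: "J \<subseteq> E" "R ?A J < card J"
      by (auto simp: good_def not_le)
    moreover have "e \<in> J"
    proof (rule ccontr)
      assume "e \<notin> J"
      then have "{f \<in> J. i \<in> ?A f} = {f \<in> J. i \<in> A f}" for i by auto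
      then have "R ?A J = R A J" unfolding R_def by presburger
      then show False using J cond[of J] by simp
    qed
    ultimately show ?thesis by blast
  qed
  have single: "\<exists>c. A e = {c}" if e: "e \<in> E" for e
  proof -
    have "A e \<noteq> {}"
    proof
      assume "A e = {}"
      then have "{f\<in>{e}. i \<in> A f} = {}" for i by auto
      then have "R A {e} = (\<Sum>i<k. r {})" unfolding R_def by presburger
      then show False using cond[of "{e}"] e r_empty by simp
    qed
    moreover have "x = y" if x: "x \<in> A e" and y: "y \<in> A e" for x y
    proof (rule ccontr)
      assume "x \<noteq> y"
      let ?Ax = "A(e := A e - {x})" and ?Ay = "A(e := A e - {y})"
      obtain J where J: "J \<subseteq> E" "e \<in> J" "R ?Ax J < card J" using violated[OF e x] by blast
      obtain K where K: "K \<subseteq> E" "e \<in> K" "R ?Ay K < card K" using violated[OF e y] by blast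
      have finJK: "finite J" "finite K" using J K fin finite_subset by blast+
      \<comment> \<open>The union contains \<open>e\<close> with its full list, as \<open>x\<close> and \<open>y\<close> differ; this is what beats the loss of
        the single element \<open>e\<close> in the intersection.\<close>
      have "card (J \<union> K) + card (J \<inter> K - {e}) \<le> R A (J \<union> K) + R A (J \<inter> K - {e})"
        using J K by (intro add_mono cond) auto
      also have "\<dots> = (\<Sum>i<k. r {f\<in>J \<union> K. i \<in> A f} + r {f\<in>J \<inter> K - {e}. i \<in> A f})"
        by (simp add: R_def sum.distrib)
      also have "\<dots> \<le> (\<Sum>i<k. r {f\<in>J. i \<in> ?Ax f} + r {f\<in>K. i \<in> ?Ay f})"
      proof (rule sum_mono)
        fix i
        let ?X = "{f\<in>J. i \<in> ?Ax f}" and ?Y = "{f\<in>K. i \<in> ?Ay f}"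
        have "{f\<in>J \<union> K. i \<in> A f} = ?X \<union> ?Y"
          using \<open>x \<noteq> y\<close> J(2) K(2) by (auto split: if_splits)
        moreover have "r {f\<in>J \<inter> K - {e}. i \<in> A f} \<le> r (?X \<inter> ?Y)"
          using J(1) by (intro mono) auto
        moreover have "r (?X \<union> ?Y) + r (?X \<inter> ?Y) \<le> r ?X + r ?Y"
          using J(1) K(1) by (intro submod) auto
        ultimately show "r {f\<in>J \<union> K. i \<in> A f} + r {f\<in>J \<inter> K - {e}. i \<in> A f} \<le> r ?X + r ?Y"
          by simp
      qed
      also have "\<dots> = R ?Ax J + R ?Ay K" by (simp add: R_def sum.distrib)
      finally have "card (J \<union> K) + card (J \<inter> K - {e}) + 2 \<le> card J + card K"
        using J(3) K(3) by linarith
      moreover have "card (J \<inter> K - {e}) + 1 = card (J \<inter> K)"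
        using J K finJK by (metis IntI Suc_eq_plus1 card_Suc_Diff1 finite_Int)
      ultimately show False using card_Un_Int[OF finJK] by linarith
    qed
    ultimately show ?thesis by blast
  qed
  define c where "c e = (THE x. A e = {x})" for e
  have Ac: "A e = {c e}" if "e \<in> E" for e using single[OF that] by (auto simp: c_def)
  show thesis
  proof
    show "\<forall>e\<in>E. c e < k"
    proof
      fix e assume "e \<in> E"
      then show "c e < k" using sub[of e] Ac[of e] by simp
    qed
    fix i J assume i: "i < k" and J: "J \<subseteq> {e\<in>E. c e = i}"
    have "r {e\<in>J. j \<in> A e} = (if j = i then r J else 0)" for j
    proof -
      have "{e\<in>J. j \<in> A e} = (if j = i then J else {})" using J Ac by auto
      then show ?thesis using r_empty by simp
    qed
    then have "R A J = r J" using i by (simp add: R_def)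
    moreover have "J \<subseteq> E" using J by auto
    ultimately show "card J \<le> r J" using cond[of J] by simp
  qed
qed

section \<open>Forests\<close>

text \<open>Finite acyclic edge sets are generated by attaching pendant edges. Both colorings and connectedness
  of plane complements are proved along this construction, one leaf at a time.\<close>

inductive leaf_forest :: "'a set set \<Rightarrow> bool" where
  empty: "leaf_forest {}"
| attach: "leaf_forest F \<Longrightarrow> u \<noteq> v \<Longrightarrow> v \<notin> \<Union>F \<Longrightarrow> leaf_forest (insert {u, v} F)"

lemma leaf_forest_edges:
  assumes "leaf_forest F"
  shows "finite F \<and> (\<forall>e\<in>F. card e = 2)"
  using assms by induction auto

lemma leaf_forest_card:
  assumes "leaf_forest F" "F \<noteq> {}"
  shows "finite (\<Union>F) \<and> card F < card (\<Union>F)"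
  using assms
proof induction
  case (attach F u v)
  show ?case
  proof (cases "F = {}")
    case True then show ?thesis using attach by auto
  next
    case False
    have fin: "finite (\<Union>F)" "finite F" using attach False leaf_forest_edges by auto
    have "card F + 1 < card (insert v (\<Union>F))" using attach False fin by simp
    also have "\<dots> \<le> card (\<Union>(insert {u,v} F))" using fin by (intro card_mono) auto
    finally have "card F + 1 < card (\<Union>(insert {u,v} F))" .
    moreover have "card (insert {u,v} F) \<le> card F + 1" using fin by (simp add: card_insert_if)
    ultimately show ?thesis using fin by simp
  qed
qed auto

text \<open>Peel off edges at vertices of degree 1. The process can only stop at a nonempty set in which
  every vertex has degree at least 2.\<close>

lemma leaf_forestI:
  assumes "finite F" "\<And>e. e \<in> F \<Longrightarrow> card e = 2"
    and "\<And>J. J \<subseteq> F \<Longrightarrow> J \<noteq> {} \<Longrightarrow> \<exists>v\<in>\<Union>J. card {e\<in>J. v \<in> e} < 2"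
  shows "leaf_forest F"
  using assms
proof (induction F rule: finite_psubset_induct)
  case (psubset F)
  show ?case
  proof (cases "F = {}")
    case True then show ?thesis using empty by simp
  next
    case False
    then obtain v e where v: "e \<in> F" "v \<in> e" "card {e\<in>F. v \<in> e} < 2"
      using psubset.prems(2)[of F] by blast
    have uniq: "f = e" if "f \<in> F" "v \<in> f" for f
    proof (rule ccontr)
      assume "f \<noteq> e"
      then have "card {e, f} \<le> card {e\<in>F. v \<in> e}"
        using v that psubset.hyps by (intro card_mono) auto
      then show False using v \<open>f \<noteq> e\<close> by simp
    qed
    obtain u where u: "e = {u, v}" "u \<noteq> v"
      using psubset.prems(1)[OF v(1)] v(2) by (auto simp: card_2_iff)
    have "leaf_forest (F - {e})"
    proof (rule psubset.IH)
      show "F - {e} \<subset> F" using v by auto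
    next
      fix J assume "J \<subseteq> F - {e}" "J \<noteq> {}"
      then show "\<exists>v\<in>\<Union>J. card {e\<in>J. v \<in> e} < 2"
        using psubset.prems(2)[of J] by blast
    qed (use psubset.prems in auto)
    moreover have "v \<notin> \<Union>(F - {e})" using uniq by auto
    ultimately have "leaf_forest (insert {u, v} (F - {e}))" using u by (intro attach)
    then show ?thesis using u v by (simp add: insert_absorb)
  qed
qed

lemma degree_sum:
  assumes "finite J" "\<And>e. e \<in> J \<Longrightarrow> card e = 2"
  shows "(\<Sum>v\<in>\<Union>J. card {e\<in>J. v \<in> e}) = 2 * card J"
proof -
  have fin: "finite (\<Union>J)" using assms by (metis card.infinite finite_Union zero_neq_numeral)
  have "(\<Sum>v\<in>\<Union>J. card {e\<in>J. v \<in> e}) = (\<Sum>v\<in>\<Union>J. \<Sum>e\<in>J. if v \<in> e then 1 else 0)"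
    using assms(1) by (simp add: sum.If_cases Int_def)
  also have "\<dots> = (\<Sum>e\<in>J. \<Sum>v\<in>\<Union>J. if v \<in> e then 1 else 0)" by (rule sum.swap)
  also have "\<dots> = (\<Sum>e\<in>J. card e)"
  proof (rule sum.cong[OF refl])
    fix e assume "e \<in> J"
    then have "\<Union>J \<inter> {v. v \<in> e} = e" by auto
    then show "(\<Sum>v\<in>\<Union>J. if v \<in> e then 1 else 0) = card e"
      using fin by (simp add: sum.If_cases)
  qed
  also have "\<dots> = 2 * card J" using assms by simp
  finally show ?thesis .
qed

text \<open>Walk along edges without turning back: three consecutive edges are distinct, and if there are no
  more than these three, the walk has to close up.\<close>

lemma min_degree_two_card:
  assumes "finite J" "J \<noteq> {}" "\<And>e. e \<in> J \<Longrightarrow> card e = 2"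
    and deg: "\<And>v. v \<in> \<Union>J \<Longrightarrow> 2 \<le> card {e\<in>J. v \<in> e}"
  shows "3 \<le> card J \<and>
    (card J = 3 \<longrightarrow> (\<exists>u v w. u \<noteq> v \<and> v \<noteq> w \<and> u \<noteq> w \<and> {u,v} \<in> J \<and> {v,w} \<in> J \<and> {u,w} \<in> J))"
proof -
  have other: "\<exists>w. {v, w} \<in> J \<and> w \<noteq> v \<and> w \<noteq> u" if uv: "{u,v} \<in> J" for u v
  proof -
    have "\<exists>f\<in>J. v \<in> f \<and> f \<noteq> {u,v}"
    proof (rule ccontr)
      assume "\<not> ?thesis"
      then have "{e\<in>J. v \<in> e} = {{u,v}}" using uv by blast
      moreover have "v \<in> \<Union>J" using uv by blast
      ultimately show False using deg[of v] by simp
    qed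
    then obtain f where f: "f \<in> J" "v \<in> f" "f \<noteq> {u,v}" by blast
    then obtain w where w: "f = {v,w}" "v \<noteq> w"
      using assms(3)[OF f(1)] by (auto simp: card_2_iff)
    then have "w \<noteq> u" using f(3) by auto
    then show ?thesis using f w by blast
  qed
  obtain u v where uv: "{u,v} \<in> J" "u \<noteq> v"
  proof -
    obtain e where "e \<in> J" using assms(2) by blast
    then show thesis using assms(3)[of e] that by (auto simp: card_2_iff)
  qed
  obtain w where w: "{v,w} \<in> J" "w \<noteq> v" "w \<noteq> u" using other uv by blast
  obtain x where x: "{w,x} \<in> J" "x \<noteq> w" "x \<noteq> v" using other w by blast
  have three: "card {{u,v},{v,w},{w,x}} = 3" using uv w x by (auto simp: doubleton_eq_iff)
  have sub: "{{u,v},{v,w},{w,x}} \<subseteq> J" using uv w x by auto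
  then have "3 \<le> card J" using card_mono[OF assms(1)] three by metis
  moreover have "x = u" if "card J = 3"
  proof -
    have J: "J = {{u,v},{v,w},{w,x}}"
      using card_subset_eq[OF assms(1) sub] three that by simp
    obtain y where y: "{u,y} \<in> J" "y \<noteq> u" "y \<noteq> v"
      using other[of v u] uv by (auto simp: insert_commute)
    show "x = u" using y w uv x unfolding J by (auto simp: doubleton_eq_iff)
  qed
  moreover have "{u,w} = {w,u}" by auto
  ultimately show ?thesis using uv w x by metis
qed

section \<open>Graphic rank and the theorem of Nash-Williams\<close>

definition linked :: "'a set set \<Rightarrow> ('a \<times> 'a) set" where
  "linked F = {(u, v). {u, v} \<in> F}\<^sup>*"

definition block :: "'a set set \<Rightarrow> 'a \<Rightarrow> 'a set" where
  "block F v = {w. (v, w) \<in> linked F}"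

text \<open>The rank of the cycle matroid, as vertices minus components; \<open>block\<close> gives the components, with
  isolated vertices as singletons.\<close>

definition graph_rank :: "'a set \<Rightarrow> 'a set set \<Rightarrow> nat" where
  "graph_rank V F = card V - card (block F ` V)"

lemma linked_refl [simp]: "(v, v) \<in> linked F" by (simp add: linked_def)

lemma block_self: "v \<in> block F v" by (simp add: block_def)

lemma linked_sym: "(u, v) \<in> linked F \<Longrightarrow> (v, u) \<in> linked F"
proof -
  have "sym {(u, v). {u, v} \<in> F}" by (auto simp: sym_def insert_commute)
  then have "sym (linked F)" unfolding linked_def by (rule sym_rtrancl)
  then show "(u, v) \<in> linked F \<Longrightarrow> (v, u) \<in> linked F" by (rule symD)
qed

lemma linked_trans: "(u, v) \<in> linked F \<Longrightarrow> (v, w) \<in> linked F \<Longrightarrow> (u, w) \<in> linked F"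
  by (auto simp: linked_def)

lemma linked_mono: "F \<subseteq> F' \<Longrightarrow> linked F \<subseteq> linked F'"
  unfolding linked_def by (rule rtrancl_mono) auto

lemma block_eq_iff: "block F u = block F v \<longleftrightarrow> (u, v) \<in> linked F"
  unfolding block_def by (auto dest: linked_sym linked_trans)

lemma linked_insert:
  "(v, w) \<in> linked (insert {a, b} F) \<longleftrightarrow>
     (v, w) \<in> linked F \<or> (v, a) \<in> linked F \<and> (b, w) \<in> linked F \<or>
     (v, b) \<in> linked F \<and> (a, w) \<in> linked F" (is "_ \<longleftrightarrow> ?R w")
proof
  assume "(v, w) \<in> linked (insert {a, b} F)"
  then show "?R w"
    unfolding linked_def[of "insert _ _"]
  proof (induction rule: rtrancl_induct)
    case base then show ?case by simp
  next
    case (step y z)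
    then consider "(y, z) \<in> linked F" | "y = a" "z = b" | "y = b" "z = a"
      by (auto simp: linked_def doubleton_eq_iff)
    then show ?case
      using step.IH by cases (auto intro: linked_trans linked_sym)
  qed
next
  have ab: "(a, b) \<in> linked (insert {a, b} F)" by (auto simp: linked_def)
  have m: "p \<in> linked (insert {a, b} F)" if "p \<in> linked F" for p
    using linked_mono[of F "insert {a,b} F"] that by auto
  show "(v, w) \<in> linked (insert {a, b} F)" if "?R w"
    using that ab linked_sym[OF ab] by (auto dest!: m intro: linked_trans)
qed

lemma block_insert:
  "block (insert {a, b} F) v =
     (if v \<in> block F a \<union> block F b then block F a \<union> block F b else block F v)"
  unfolding block_def by (auto simp: linked_insert dest: linked_sym intro: linked_trans linked_sym)

lemma graph_rank_insert:
  assumes "finite V" "a \<in> V" "b \<in> V"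
  shows "graph_rank V (insert {a, b} F) =
    graph_rank V F + (if (a, b) \<in> linked F then 0 else 1)"
proof (cases "(a, b) \<in> linked F")
  case True
  have "(v, w) \<in> linked (insert {a, b} F) \<longleftrightarrow> (v, w) \<in> linked F" for v w
    unfolding linked_insert by (meson True linked_sym linked_trans)
  then have "block (insert {a, b} F) = block F" by (simp add: block_def fun_eq_iff)
  then show ?thesis using True by (simp add: graph_rank_def)
next
  case False
  let ?B = "block F ` V" and ?a = "block F a" and ?b = "block F b"
  have ne: "?a \<noteq> ?b" using False block_eq_iff by metis
  note self = block_self[of _ F]
  have in_iff: "v \<in> block F u \<longleftrightarrow> block F v = block F u" for u v
    by (metis block_def block_eq_iff linked_sym mem_Collect_eq)
  have img: "block (insert {a, b} F) ` V = insert (?a \<union> ?b) (?B - {?a, ?b})" (is "?L = ?R")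
  proof
    show "?L \<subseteq> ?R" using in_iff by (auto simp: block_insert)
    show "?R \<subseteq> ?L"
    proof
      fix B assume "B \<in> ?R"
      then consider "B = ?a \<union> ?b" | v where "v \<in> V" "B = block F v" "B \<noteq> ?a" "B \<noteq> ?b" by auto
      then show "B \<in> ?L"
      proof cases
        case 1 then show ?thesis using assms self by (auto simp: block_insert intro!: image_eqI[of _ _ a])
      next
        case 2 then show ?thesis using in_iff by (auto simp: block_insert intro!: image_eqI[of _ _ v])
      qed
    qed
  qed
  have new: "?a \<union> ?b \<notin> ?B"
  proof
    assume "?a \<union> ?b \<in> ?B"
    then obtain v where "?a \<union> ?b = block F v" by auto
    then show False using self in_iff ne by (metis UnI1 UnI2)
  qed
  have "card (?B - {?a, ?b}) = card ?B - 2"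
    using assms ne by (subst card_Diff_subset) auto
  moreover have "2 \<le> card ?B"
  proof -
    have "card {?a, ?b} \<le> card ?B" using assms by (intro card_mono) auto
    then show ?thesis using ne by simp
  qed
  ultimately have "card (block (insert {a, b} F) ` V) + 1 = card ?B"
    using assms new by (simp add: img)
  moreover have "card ?B \<le> card V" using assms card_image_le by blast
  ultimately show ?thesis using False by (simp add: graph_rank_def)
qed

lemma graph_rank_empty: "graph_rank V {} = 0"
proof -
  have "inj_on (block {}) V"
    by (rule inj_onI) (simp add: block_eq_iff, simp add: linked_def)
  then show ?thesis by (simp add: graph_rank_def card_image)
qed

text \<open>An edge that joins two components of the larger graph also joins two components of the smaller.\<close>

lemma graph_rank_diminishing:
  assumes "finite V" "card e = 2" "e \<subseteq> V" "A \<subseteq> B"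
  shows "graph_rank V (insert e B) + graph_rank V A \<le> graph_rank V (insert e A) + graph_rank V B"
proof -
  obtain a b where e: "e = {a, b}" using assms(2) by (auto simp: card_2_iff)
  then show ?thesis
    using assms linked_mono[OF assms(4)] graph_rank_insert[of V a b] by auto
qed

lemma graph_rank_mono:
  assumes "finite V" "finite B" "\<And>e. e \<in> B \<Longrightarrow> card e = 2 \<and> e \<subseteq> V" "A \<subseteq> B"
  shows "graph_rank V A \<le> graph_rank V B"
proof -
  have "graph_rank V A \<le> graph_rank V (A \<union> D)" if "D \<subseteq> B" "finite D" for D
    using that(2,1)
  proof (induction D)
    case (insert e D)
    then obtain a b where "e = {a, b}" using assms(3) by (metis card_2_iff insert_subset)
    then show ?case using graph_rank_insert[of V a b "A \<union> D"] assms insert by fastforce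
  qed auto
  from this[of B] show ?thesis using assms by (simp add: Un_absorb1)
qed

lemma graph_rank_submodular:
  assumes V: "finite V" and A: "finite A" "\<And>e. e \<in> A \<Longrightarrow> card e = 2 \<and> e \<subseteq> V"
    and B: "finite B" "\<And>e. e \<in> B \<Longrightarrow> card e = 2 \<and> e \<subseteq> V"
  shows "graph_rank V (A \<union> B) + graph_rank V (A \<inter> B) \<le> graph_rank V A + graph_rank V B"
proof -
  have "graph_rank V (A \<union> D) + graph_rank V (A \<inter> B) \<le> graph_rank V A + graph_rank V ((A \<inter> B) \<union> D)"
    if "D \<subseteq> B" "finite D" for D
    using that(2,1)
  proof (induction D)
    case (insert e D)
    then have "graph_rank V (insert e (A \<union> D)) + graph_rank V ((A \<inter> B) \<union> D) \<le>
        graph_rank V (insert e ((A \<inter> B) \<union> D)) + graph_rank V (A \<union> D)"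
      using V B by (intro graph_rank_diminishing) auto
    then show ?case using insert by auto
  qed auto
  from this[of B] show ?thesis using B by (simp add: Un_absorb1 Int_absorb1)
qed

text \<open>Apply the covering theorem to the graphic rank. The density of the blocks adds up to
  \<open>card J \<le> k * graph_rank V J\<close>. Conversely, every nonempty \<open>J\<close> within a color class
  has \<open>card J \<le> graph_rank V J\<close>, so it has fewer edges than end vertices, and by its degree sum it has a vertex of degree 1.\<close>

lemma nash_williams:
  assumes V: "finite V" and E: "\<And>e. e \<in> E \<Longrightarrow> card e = 2 \<and> e \<subseteq> V"
    and dens: "\<And>U. U \<subseteq> V \<Longrightarrow> U \<noteq> {} \<Longrightarrow> card {e\<in>E. e \<subseteq> U} \<le> k * (card U - 1)"
  obtains c where "\<forall>e\<in>E. c e < k" "\<And>i. i < k \<Longrightarrow> leaf_forest {e\<in>E. c e = i}"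
proof -
  have finE: "finite E" using V E by (meson Pow_iff finite_Pow_iff finite_subset subsetI)
  have bsub: "block J v \<subseteq> V" if "v \<in> V" "J \<subseteq> E" for v J
  proof
    fix w assume "w \<in> block J v"
    then have "(v, w) \<in> {(u, v). {u, v} \<in> J}\<^sup>*" by (simp add: block_def linked_def)
    then show "w \<in> V" by induction (use that E in auto)
  qed
  have rank_dens: "card J \<le> k * graph_rank V J" if J: "J \<subseteq> E" for J
  proof -
    let ?B = "block J ` V"
    have finJ: "finite J" using finE J finite_subset by blast
    have union: "\<Union>?B = V" using bsub J by (auto simp: block_def)
    have disj: "B \<inter> C = {}" if "B \<in> ?B" "C \<in> ?B" "B \<noteq> C" for B C
      using that block_eq_iff[of J] by (auto simp: block_def dest: linked_sym linked_trans)
    have finB: "finite B" if "B \<in> ?B" for B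
      using that bsub[OF _ J] finite_subset[OF _ V] by blast
    have neB: "B \<noteq> {}" if "B \<in> ?B" for B using that block_self by (metis equals0D imageE)
    have "card (\<Union>?B) = (\<Sum>B\<in>?B. card B)"
      using disj finB by (intro card_Union_disjoint) (simp_all add: pairwise_def disjnt_def)
    then have card: "card V = (\<Sum>B\<in>?B. card B)" by (simp only: union)
    have "card J \<le> card (\<Union>B\<in>?B. {e\<in>J. e \<subseteq> B})"
    proof (rule card_mono)
      show "finite (\<Union>B\<in>?B. {e\<in>J. e \<subseteq> B})" using V finJ by auto
      show "J \<subseteq> (\<Union>B\<in>?B. {e\<in>J. e \<subseteq> B})"
      proof
        fix e assume e: "e \<in> J"
        then obtain u v where uv: "e = {u, v}" "u \<in> V" using E J by (metis card_2_iff insert_subset subsetD)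
        moreover have "(u, v) \<in> linked J" using e uv unfolding linked_def by blast
        ultimately have "e \<subseteq> block J u" using block_self by (simp add: block_def)
        then show "e \<in> (\<Union>B\<in>?B. {e\<in>J. e \<subseteq> B})" using e uv by auto
      qed
    qed
    also have "\<dots> \<le> (\<Sum>B\<in>?B. card {e\<in>J. e \<subseteq> B})" using V by (intro card_UN_le) auto
    also have "\<dots> \<le> (\<Sum>B\<in>?B. k * (card B - 1))"
    proof (rule sum_mono)
      fix B assume B: "B \<in> ?B"
      then have "B \<subseteq> V" "B \<noteq> {}" using bsub[OF _ J] neB by auto
      have "card {e\<in>J. e \<subseteq> B} \<le> card {e\<in>E. e \<subseteq> B}" using finE J by (intro card_mono) auto
      also have "\<dots> \<le> k * (card B - 1)" by (rule dens) fact+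
      finally show "card {e\<in>J. e \<subseteq> B} \<le> k * (card B - 1)" .
    qed
    also have "\<dots> = k * ((\<Sum>B\<in>?B. card B) - (\<Sum>B\<in>?B. 1))"
    proof -
      have "1 \<le> card B" if "B \<in> ?B" for B
        using finB[OF that] neB[OF that] by (simp add: Suc_leI card_gt_0_iff)
      then show ?thesis by (simp add: sum_distrib_left[symmetric] sum_subtractf_nat)
    qed
    finally show ?thesis using card by (simp add: graph_rank_def)
  qed
  have finS: "finite B" if "B \<subseteq> E" for B using finE that finite_subset by blast
  have ES: "card e = 2 \<and> e \<subseteq> V" if "B \<subseteq> E" "e \<in> B" for B e using E that by blast
  obtain c where c: "\<forall>e\<in>E. c e < k"
    and indep: "\<And>i J. i < k \<Longrightarrow> J \<subseteq> {e\<in>E. c e = i} \<Longrightarrow> card J \<le> graph_rank V J"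
  proof (rule submodular_cover[of E "graph_rank V" k])
    show "graph_rank V A \<le> graph_rank V B" if "A \<subseteq> B" "B \<subseteq> E" for A B
      by (rule graph_rank_mono[OF V finS[OF that(2)] ES[OF that(2)] that(1)])
    show "graph_rank V (A \<union> B) + graph_rank V (A \<inter> B) \<le> graph_rank V A + graph_rank V B"
      if "A \<subseteq> E" "B \<subseteq> E" for A B
      by (rule graph_rank_submodular[OF V finS[OF that(1)] ES[OF that(1)] finS[OF that(2)] ES[OF that(2)]])
  qed (use finE graph_rank_empty rank_dens in auto)
  have "leaf_forest {e\<in>E. c e = i}" if i: "i < k" for i
  proof (rule leaf_forestI)
    fix J assume J: "J \<subseteq> {e\<in>E. c e = i}" "J \<noteq> {}"
    have JE: "J \<subseteq> E" using J(1) by blast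
    have finJ: "finite J" by (rule finS[OF JE])
    have J2: "card e = 2" if "e \<in> J" for e using ES[OF JE that] by blast
    have UJ: "\<Union>J \<subseteq> V" using ES[OF JE] by blast
    have finU: "finite (\<Union>J)" by (rule finite_subset[OF UJ V])
    obtain x where x: "x \<in> \<Union>J"
    proof -
      obtain e where "e \<in> J" using J(2) by blast
      moreover obtain x where "x \<in> e" using J2[OF calculation] by (auto simp: card_2_iff)
      ultimately show thesis using that by blast
    qed
    have "card V - card (\<Union>J) + 1 \<le> card (block J ` V)"
    proof -
      have alone: "block J v = {v}" if "v \<notin> \<Union>J" for v
      proof -
        have "w = v" if "(v, w) \<in> linked J" for w
          using that \<open>v \<notin> \<Union>J\<close> unfolding linked_def
          by (induction rule: rtrancl_induct) auto
        then show ?thesis by (auto simp: block_def)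
      qed
      \<comment> \<open>Isolated vertices are blocks of their own, and the block of \<open>x\<close> is yet another one.\<close>
      have "inj_on (block J) (insert x (V - \<Union>J))"
      proof (rule inj_onI)
        fix u v assume "u \<in> insert x (V - \<Union>J)" "v \<in> insert x (V - \<Union>J)" "block J u = block J v"
        then show "u = v" using alone
          by (metis DiffE block_def insertE linked_refl mem_Collect_eq singletonD)
      qed
      then have "card (insert x (V - \<Union>J)) = card (block J ` insert x (V - \<Union>J))"
        by (metis card_image)
      also have "\<dots> \<le> card (block J ` V)" using x UJ V by (intro card_mono) auto
      finally show ?thesis using x V UJ finU by (simp add: card_Diff_subset)
    qed
    moreover have "0 < card (\<Union>J)" using x finU card_gt_0_iff by blast
    ultimately have "graph_rank V J < card (\<Union>J)"
      using card_mono[OF V UJ] unfolding graph_rank_def by linarith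
    then have less: "card J < card (\<Union>J)" using indep[OF i J(1)] by simp
    show "\<exists>v\<in>\<Union>J. card {e\<in>J. v \<in> e} < 2"
    proof (rule ccontr)
      assume "\<not> ?thesis"
      then have "2 \<le> card {e\<in>J. v \<in> e}" if "v \<in> \<Union>J" for v using that not_less by blast
      then have "(\<Sum>v\<in>\<Union>J. 2) \<le> (\<Sum>v\<in>\<Union>J. card {e\<in>J. v \<in> e})"
        by (rule sum_mono)
      then show False using degree_sum[OF finJ J2] less by simp
    qed
  qed (use finE E in auto)
  then show thesis using that c by blast
qed

section \<open>Cutting a plane region along an arc\<close>

text \<open>A nonzero power winds around 0 along a circle. Subtracting from \<open>h\<close> the logarithm that grows
  linearly in the angle leaves a continuous function with values in \<open>2 * pi * \<i> * \<int>\<close>, hence a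
  constant, which rules out any growth over a full turn.\<close>

lemma power_int_log_on_circle:
  fixes h :: "complex \<Rightarrow> complex"
  assumes "0 < R" "continuous_on (sphere a R) h"
    and h: "\<And>x. x \<in> sphere a R \<Longrightarrow> (x - a) powi m = exp (h x)"
  shows "m = 0"
proof -
  define c where "c t = a + of_real R * exp (2 * of_real pi * \<i> * of_real t)" for t :: real
  define d where "d t = h (c t) - of_int m * (of_real (ln R) + 2 * of_real pi * \<i> * of_real t)" for t
  have c: "c t \<in> sphere a R" for t
    using assms(1) by (simp add: c_def dist_norm norm_mult norm_exp_eq_Re)
  have cont: "continuous_on {0..1} d"
    unfolding d_def
    by (intro continuous_intros continuous_on_compose2[OF assms(2)]) (use c in \<open>auto simp: c_def[abs_def] intro!: continuous_intros\<close>)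
  have "exp (d t) = 1" for t
  proof -
    have "c t - a = exp (of_real (ln R) + 2 * of_real pi * \<i> * of_real t)"
      using assms(1) by (simp add: c_def exp_add exp_of_real)
    then have "exp (h (c t)) = exp (of_int m * (of_real (ln R) + 2 * of_real pi * \<i> * of_real t))"
      using h[OF c, of t] by (simp add: exp_power_int)
    then show ?thesis by (simp add: d_def exp_diff)
  qed
  then have "Re (d t) = 0 \<and> (\<exists>n::int. Im (d t) = of_int (2 * n) * pi)" for t
    using exp_eq_1 by blast
  then have range: "\<exists>n::int. d t = of_int (2 * n) * pi * \<i>" for t
    by (simp add: complex_eq_iff)
  have "d constant_on {0..1}"
  proof (rule continuous_discrete_range_constant[OF _ cont])
    fix x :: real
    show "\<exists>e>0. \<forall>y. y \<in> {0..1} \<and> d y \<noteq> d x \<longrightarrow> e \<le> cmod (d y - d x)"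
    proof (intro exI[of _ "2 * pi"] conjI allI impI)
      fix y assume y: "y \<in> {0..1} \<and> d y \<noteq> d x"
      obtain n n' where n: "d x = of_int (2 * n) * pi * \<i>" "d y = of_int (2 * n') * pi * \<i>"
        using range by metis
      then have "n \<noteq> n'" using y by auto
      then have "1 \<le> \<bar>real_of_int (n' - n)\<bar>" by linarith
      moreover have "d y - d x = of_real (2 * of_int (n' - n) * pi) * \<i>"
        by (simp add: n algebra_simps)
      then have "cmod (d y - d x) = 2 * \<bar>real_of_int (n' - n)\<bar> * pi"
        by (simp add: norm_mult abs_mult del: of_int_diff of_real_mult)
      ultimately show "2 * pi \<le> cmod (d y - d x)" by (simp add: mult_left_mono)
    qed simp
  qed simp
  then have "d 0 = d 1" by (auto simp: constant_on_def)
  moreover have "c 0 = c 1" by (simp add: c_def)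
  ultimately show "m = 0" by (simp add: d_def algebra_simps)
qed

lemma frontier_component_of_complement:
  fixes K :: "complex set"
  assumes "closed K"
  shows "frontier (connected_component_set (- K) a) \<subseteq> K"
  using frontier_of_connected_component_subset[of "- K" a] assms
  by (metis dual_order.trans frontier_complement frontier_subset_closed)

text \<open>If \<open>(x - a) powi m * w x\<close> had a logarithm on \<open>K\<close>, extend it to the plane and use it to fill in
  \<open>(x - a) powi m\<close> across the bounded component \<open>D\<close> of \<open>a\<close>. The result is continuous and never zero
  on the whole plane, so it has a logarithm there; on a circle beyond \<open>D\<close> it is still
  \<open>(x - a) powi m\<close>. The factor \<open>w\<close> leaves room for zeros and poles in other components.\<close>

lemma log_around_bounded_component:
  fixes K :: "complex set"
  assumes K: "compact K" and a: "a \<notin> K" and bdd: "bounded (connected_component_set (- K) a)"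
    and w: "continuous_on (closure (connected_component_set (- K) a)) w"
      "\<And>x. x \<in> closure (connected_component_set (- K) a) \<Longrightarrow> w x \<noteq> 0"
    and g: "continuous_on K g" "\<And>x. x \<in> K \<Longrightarrow> (x - a) powi m * w x = exp (g x)"
  shows "m = 0"
proof -
  let ?D = "connected_component_set (- K) a"
  have aD: "a \<in> ?D" using a by simp
  have openD: "open ?D" using K by (simp add: compact_imp_closed open_Compl open_connected_component)
  have "frontier ?D \<subseteq> K"
    by (rule frontier_component_of_complement[OF compact_imp_closed[OF K]])
  obtain G where G: "continuous_on UNIV G" "\<And>x. x \<in> K \<Longrightarrow> G x = g x"
    using Dugundji[of UNIV UNIV K g] K g(1) by (auto simp: compact_imp_closed)
  define u where "u x = (if x \<in> closure ?D then exp (G x) / w x else (x - a) powi m)" for x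
  have "continuous_on (closure ?D \<union> - ?D) u"
    unfolding u_def
  proof (rule continuous_on_cases)
    show "continuous_on (closure ?D) (\<lambda>x. exp (G x) / w x)"
      using w G by (auto intro!: continuous_intros intro: continuous_on_subset)
    show "continuous_on (- ?D) (\<lambda>x. (x - a) powi m)"
      using aD by (auto intro!: continuous_intros)
    have "exp (G x) / w x = (x - a) powi m" if "x \<in> - ?D \<and> x \<in> closure ?D" for x
    proof -
      from that have x: "x \<in> closure ?D" "x \<in> frontier ?D"
        using openD by (auto simp: frontier_def interior_open)
      then have "x \<in> K" using \<open>frontier ?D \<subseteq> K\<close> by auto
      then show ?thesis
        using g(2)[of x] G(2)[of x] w(2)[OF x(1)] by (simp add: field_simps)
    qed
    then show "\<forall>x. x \<in> closure ?D \<and> x \<notin> closure ?D \<or> x \<in> - ?D \<and> x \<in> closure ?D \<longrightarrow>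
      exp (G x) / w x = (x - a) powi m" by blast
  qed (use openD in auto)
  moreover have "closure ?D \<union> - ?D = UNIV" using closure_subset by blast
  ultimately have cont_u: "continuous_on UNIV u" by simp
  have "u x \<noteq> 0" for x
  proof (cases "x \<in> closure ?D")
    case True
    then show ?thesis using w(2)[of x] by (simp add: u_def)
  next
    case False
    then have "x \<noteq> a" using aD closure_subset by blast
    then show ?thesis using False by (simp add: u_def power_int_eq_0_iff)
  qed
  then obtain h where h: "continuous_on UNIV h" "\<And>x. u x = exp (h x)"
    using continuous_logarithm_on_contractible[OF cont_u] by auto
  obtain R where R: "0 < R" "closure ?D \<subseteq> ball a R"
    using bounded_subset_ballD[of "closure ?D" a] bdd by auto
  show ?thesis
  proof (rule power_int_log_on_circle[OF R(1)])
    show "continuous_on (sphere a R) h" using h continuous_on_subset by blast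
    show "(x - a) powi m = exp (h x)" if "x \<in> sphere a R" for x
    proof -
      have "x \<notin> ball a R" using that by simp
      then have "x \<notin> closure ?D" using R(2) by blast
      then show ?thesis using h(2)[of x] by (simp add: u_def)
    qed
  qed
qed

text \<open>Moving \<open>a\<close> to \<open>b\<close> inside the complement of \<open>K\<close> deforms the quotient to the constant 1.\<close>

lemma log_same_component:
  fixes K :: "complex set"
  assumes "connected_component (- K) a b" "closed K"
  obtains g where "continuous_on K g" "\<And>x. x \<in> K \<Longrightarrow> (x - a) / (x - b) = exp (g x)"
proof -
  have "path_component (- K) a b"
    using assms by (simp add: open_Compl open_path_connected_component)
  then obtain q where q: "path q" "path_image q \<subseteq> - K" "pathstart q = a" "pathfinish q = b"
    by (auto simp: path_component_def)
  have b: "b \<notin> K" using q by (metis ComplD pathfinish_in_path_image subsetD)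
  have "homotopic_with_canon (\<lambda>h. True) K (- {0}) (\<lambda>x. (x - a) / (x - b)) (\<lambda>x. 1)"
  proof -
    have cq: "continuous_on {0..1} q" using q by (simp add: path_def)
    have "continuous_on ({0..1} \<times> K) (\<lambda>z. (snd z - q (fst z)) / (snd z - b))"
      using b by (intro continuous_intros continuous_on_compose2[OF cq]) auto
    moreover have "(snd z - q (fst z)) / (snd z - b) \<noteq> 0" if "z \<in> {0..1} \<times> K" for z
      using that b q by (auto simp: path_image_def)
    ultimately have "homotopic_with_canon (\<lambda>h. True) K (- {0}) (\<lambda>x. (x - a) / (x - b)) (\<lambda>x. (x - b) / (x - b))"
      using q(3,4) unfolding homotopic_with_def
      by (intro exI[of _ "\<lambda>z. (snd z - q (fst z)) / (snd z - b)"])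
        (auto simp: pathstart_def pathfinish_def prod_topology_subtopology_eu)
    then show ?thesis
      by (rule homotopic_with_eq) (use b in auto)
  qed
  then have "\<exists>g. continuous_on K g \<and> (\<forall>x\<in>K. (x - a) / (x - b) = exp (g x))"
    using inessential_eq_continuous_logarithm[of K "\<lambda>x. (x - a) / (x - b)"] by blast
  then show thesis using that by blast
qed

lemma no_log_at_bounded_component:
  fixes K :: "complex set"
  assumes K: "compact K" and a: "a \<notin> K" "b \<notin> K" "c \<notin> K"
    and bdd: "bounded (connected_component_set (- K) a)"
    and sep: "\<not> connected_component (- K) a b" "\<not> connected_component (- K) a c"
    and g: "continuous_on K g"
      "\<And>x. x \<in> K \<Longrightarrow> exp (g x) = (x - a) powi i * (x - b) powi j * (x - c) powi k"
  shows "i = 0"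
proof (rule log_around_bounded_component[OF K a(1) bdd])
  let ?D = "connected_component_set (- K) a"
  have "frontier ?D \<subseteq> K"
    by (rule frontier_component_of_complement[OF compact_imp_closed[OF K]])
  then have cl: "closure ?D \<subseteq> ?D \<union> K" unfolding closure_Un_frontier by blast
  have bc: "b \<notin> closure ?D" "c \<notin> closure ?D" using cl a sep by auto
  show "continuous_on (closure ?D) (\<lambda>x. (x - b) powi j * (x - c) powi k)"
    using bc by (auto intro!: continuous_intros)
  show "(x - b) powi j * (x - c) powi k \<noteq> 0" if "x \<in> closure ?D" for x
    using bc that by (auto simp: power_int_eq_0_iff)
  show "(x - a) powi i * ((x - b) powi j * (x - c) powi k) = exp (g x)" if "x \<in> K" for x
    using g(2)[OF that] by (simp add: mult.assoc)
qed (rule g(1))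

text \<open>One half of Alexander duality for a single arc. The quotients \<open>(x - a) / (x - b)\<close> and
  \<open>(x - a) / (x - c)\<close> have logarithms on \<open>K\<close> and on the arc; over the two ends of the arc these
  differ by integer multiples \<open>n\<close> and \<open>n'\<close> of \<open>2 * pi * \<i>\<close>. One integer relation between \<open>n\<close> and \<open>n'\<close> gives
  a nontrivial product of powers of the quotients whose logarithms do fit together. If \<open>a\<close>, \<open>b\<close>,
  \<open>c\<close> were in three components, the exponents at the bounded ones would vanish; as at most one
  component is unbounded and the exponents add up to 0, all would vanish.\<close>

lemma arc_splits_in_at_most_two:
  fixes K :: "complex set"
  assumes K: "compact K" and e: "arc e" and ends: "path_image e \<inter> K = {pathstart e, pathfinish e}"
    and out: "a \<notin> K \<union> path_image e" "b \<notin> K \<union> path_image e" "c \<notin> K \<union> path_image e"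
    and ab: "connected_component (- K) a b" and ac: "connected_component (- K) a c"
  shows "connected_component (- (K \<union> path_image e)) a b \<or>
    connected_component (- (K \<union> path_image e)) a c \<or>
    connected_component (- (K \<union> path_image e)) b c"
proof (rule ccontr)
  let ?P = "path_image e" and ?p = "pathstart e" and ?q = "pathfinish e"
  assume "\<not> ?thesis"
  then have sep: "\<not> connected_component (- (K \<union> ?P)) a b" "\<not> connected_component (- (K \<union> ?P)) a c"
    "\<not> connected_component (- (K \<union> ?P)) b c" by auto
  have compP: "compact ?P" using e by (simp add: compact_arc_image)
  have closed: "closed K" "closed ?P" using K compP by (simp_all add: compact_imp_closed)
  have contr: "contractible ?P"
    using homeomorphic_contractible_eq[OF homeomorphic_arc_image_interval[OF e, of 0 1]]
    by (simp add: convex_imp_contractible)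
  obtain g where g: "continuous_on K g" "\<And>x. x \<in> K \<Longrightarrow> (x - a) / (x - b) = exp (g x)"
    using log_same_component[OF ab closed(1)] by blast
  obtain g' where g': "continuous_on K g'" "\<And>x. x \<in> K \<Longrightarrow> (x - a) / (x - c) = exp (g' x)"
    using log_same_component[OF ac closed(1)] by blast
  have logP: "\<exists>h. continuous_on ?P h \<and> (\<forall>x\<in>?P. (x - u) / (x - v) = exp (h x))"
    if "u \<notin> ?P" "v \<notin> ?P" for u v
  proof -
    have "continuous_on ?P (\<lambda>x. (x - u) / (x - v))"
      using that by (auto intro!: continuous_intros)
    then show ?thesis
    proof (rule continuous_logarithm_on_contractible[OF _ contr])
      show "(x - u) / (x - v) \<noteq> 0" if "x \<in> ?P" for x
        using that \<open>u \<notin> ?P\<close> \<open>v \<notin> ?P\<close> by auto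
    qed blast
  qed
  obtain h where h: "continuous_on ?P h" "\<And>x. x \<in> ?P \<Longrightarrow> (x - a) / (x - b) = exp (h x)"
    using logP[of a b] out by auto
  obtain h' where h': "continuous_on ?P h'" "\<And>x. x \<in> ?P \<Longrightarrow> (x - a) / (x - c) = exp (h' x)"
    using logP[of a c] out by auto
  have in_both: "?p \<in> K" "?p \<in> ?P" "?q \<in> K" "?q \<in> ?P" using ends by auto
  have jump: "\<exists>n::int. (u ?q - v ?q) - (u ?p - v ?p) = of_int n * (2 * of_real pi * \<i>)"
    if "exp (u ?q) = exp (v ?q)" "exp (u ?p) = exp (v ?p)" for u v :: "complex \<Rightarrow> complex"
  proof -
    have "exp ((u ?q - v ?q) - (u ?p - v ?p)) = 1" using that by (simp add: exp_diff)
    then obtain n where "Re ((u ?q - v ?q) - (u ?p - v ?p)) = 0"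
      "Im ((u ?q - v ?q) - (u ?p - v ?p)) = of_int (2 * n) * pi"
      using exp_eq_1 by blast
    then show ?thesis by (intro exI[of _ n]) (simp add: complex_eq_iff)
  qed
  obtain n where n: "(h ?q - g ?q) - (h ?p - g ?p) = of_int n * (2 * of_real pi * \<i>)"
    using jump[of h g] h(2) g(2) in_both by metis
  obtain n' where n': "(h' ?q - g' ?q) - (h' ?p - g' ?p) = of_int n' * (2 * of_real pi * \<i>)"
    using jump[of h' g'] h'(2) g'(2) in_both by metis
  obtain k l :: int where kl: "k * n + l * n' = 0" "k \<noteq> 0 \<or> l \<noteq> 0"
  proof (cases "n = 0 \<and> n' = 0")
    case True then show thesis using that[of 1 0] by simp
  next
    case False then show thesis using that[of n' "- n"] by (auto simp: mult.commute)
  qed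
  \<comment> \<open>The constant \<open>s\<close> shifts the logarithm on the arc so that it agrees at the start; the relation
    between \<open>n\<close> and \<open>n'\<close> makes it agree at the other end.\<close>
  define s where "s = of_int k * (h ?p - g ?p) + of_int l * (h' ?p - g' ?p)"
  define L where "L x = (if x \<in> K then of_int k * g x + of_int l * g' x
      else of_int k * h x + of_int l * h' x - s)" for x
  have exp_s: "exp s = 1"
  proof -
    have "exp (h ?p - g ?p) = 1" "exp (h' ?p - g' ?p) = 1"
      using h(2)[of ?p] g(2)[of ?p] h'(2)[of ?p] g'(2)[of ?p] in_both by (simp_all add: exp_diff)
    then show ?thesis by (simp add: s_def exp_add flip: exp_power_int)
  qed
  have agree: "of_int k * g x + of_int l * g' x = of_int k * h x + of_int l * h' x - s"
    if "x \<in> K" "x \<in> ?P" for x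
  proof -
    have "x = ?p \<or> x = ?q" using that ends by blast
    then show ?thesis
    proof
      assume "x = ?p" then show ?thesis by (simp add: s_def algebra_simps)
    next
      assume x: "x = ?q"
      have "of_int k * ((h ?q - g ?q) - (h ?p - g ?p)) + of_int l * ((h' ?q - g' ?q) - (h' ?p - g' ?p)) =
          of_int (k * n + l * n') * (2 * of_real pi * \<i>)"
        unfolding n n' by (simp add: algebra_simps)
      then have "of_int k * ((h ?q - g ?q) - (h ?p - g ?p)) + of_int l * ((h' ?q - g' ?q) - (h' ?p - g' ?p)) = 0"
        by (simp add: kl(1))
      then show ?thesis unfolding x s_def by (simp add: algebra_simps)
    qed
  qed
  have contL: "continuous_on (K \<union> ?P) L"
    unfolding L_def
  proof (rule continuous_on_cases)
    show "continuous_on K (\<lambda>x. of_int k * g x + of_int l * g' x)"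
      using g g' by (auto intro!: continuous_intros)
    show "continuous_on ?P (\<lambda>x. of_int k * h x + of_int l * h' x - s)"
      using h h' by (auto intro!: continuous_intros)
  qed (use closed agree in auto)
  have expL: "exp (L x) = (x - a) powi (k + l) * (x - b) powi (- k) * (x - c) powi (- l)"
    if x: "x \<in> K \<union> ?P" for x
  proof -
    have nz: "x - a \<noteq> 0" "x - b \<noteq> 0" "x - c \<noteq> 0" using x out by auto
    have "exp (L x) = ((x - a) / (x - b)) powi k * ((x - a) / (x - c)) powi l"
    proof (cases "x \<in> K")
      case True
      then show ?thesis using g(2) g'(2) by (simp add: L_def exp_add exp_power_int)
    next
      case False
      then show ?thesis using x h(2) h'(2) exp_s by (simp add: L_def exp_add exp_diff exp_power_int)
    qed
    then show ?thesis
      using nz by (simp add: power_int_divide_distrib power_int_add power_int_minus field_simps)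
  qed
  let ?K = "K \<union> ?P"
  have KP: "compact ?K" using K compP by blast
  have uniq: "bounded (connected_component_set (- ?K) u) \<or> bounded (connected_component_set (- ?K) v)"
    if "\<not> connected_component (- ?K) u v" "u \<notin> ?K" "v \<notin> ?K" for u v
    using cobounded_unique_unbounded_component[of "- ?K" u v] that KP
    by (metis ComplI DIM_complex compact_imp_bounded connected_component_eq_eq double_complement order_refl)
  have sym: "\<not> connected_component (- ?K) b a" "\<not> connected_component (- ?K) c a"
    "\<not> connected_component (- ?K) c b" using sep connected_component_sym by blast+
  have za: "k + l = 0" if "bounded (connected_component_set (- ?K) a)"
    by (rule no_log_at_bounded_component[OF KP out that sep(1,2) contL expL])
  have zb: "- k = 0" if "bounded (connected_component_set (- ?K) b)"
    by (rule no_log_at_bounded_component[where i = "- k" and j = "k + l" and k = "- l", OF KP out(2,1,3) that sym(1) sep(3) contL])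
      (simp add: expL mult_ac)
  have zc: "- l = 0" if "bounded (connected_component_set (- ?K) c)"
    by (rule no_log_at_bounded_component[where i = "- l" and j = "k + l" and k = "- k", OF KP out(3,1,2) that sym(2,3) contL])
      (simp add: expL mult_ac)
  show False
    using uniq[OF sep(1) out(1,2)] uniq[OF sep(2) out(1,3)] uniq[OF sep(3) out(2,3)] za zb zc kl(2)
    by auto
qed

text \<open>Removing an inner point disconnects an arc but not a disc.\<close>

lemma path_image_arc_meets_complement:
  fixes e :: "real \<Rightarrow> complex"
  assumes e: "arc e" and U: "open U" "U \<noteq> {}"
  shows "\<exists>x\<in>U. x \<notin> path_image e"
proof (rule ccontr)
  assume "\<not> ?thesis"
  then have sub: "U \<subseteq> path_image e" by blast
  obtain x0 r where x0: "x0 \<in> U" and r: "0 < r" "ball x0 r \<subseteq> U"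
    using U by (metis equals0I open_contains_ball)
  let ?B = "ball x0 r"
  have inj: "inj_on e {0..1}" and cont: "continuous_on {0..1} e"
    using e by (auto simp: arc_def path_def)
  define T where "T = {t\<in>{0..1}. e t \<in> ?B}"
  have eT: "e ` T = ?B" using sub r by (auto simp: T_def path_image_def)
  have "infinite T"
  proof
    assume "finite T"
    then have "finite ?B" using eT finite_imageI by metis
    then show False using finite_imp_not_open[of ?B] r by auto
  qed
  then obtain T3 where T3: "T3 \<subseteq> T" "card T3 = 3" "finite T3"
    using infinite_arbitrarily_large by (metis numeral_3_eq_3)
  obtain t1 t2 t3 where t: "t1 < t2" "t2 < t3" "t1 \<in> T" "t2 \<in> T" "t3 \<in> T"
  proof -
    obtain a b c where abc: "T3 = {a, b, c}" "a \<noteq> b" "b \<noteq> c" "a \<noteq> c"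
      using T3(2) unfolding card_3_iff by blast
    then have "a \<in> T" "b \<in> T" "c \<in> T" using T3 by blast+
    then show thesis using that abc(2-4) by (metis linorder_neqE_linordered_idom)
  qed
  have t01: "{t1, t2, t3} \<subseteq> {0..1}" using t by (auto simp: T_def)
  have "connected (?B - {e t2})" by (rule connected_open_delete) auto
  moreover have "closed (e ` {0..t2})" "closed (e ` {t2..1})"
    using t01 cont by (auto intro!: compact_imp_closed compact_continuous_image intro: continuous_on_subset)
  moreover have "?B - {e t2} \<subseteq> e ` {0..t2} \<union> e ` {t2..1}"
    using eT by (force simp: T_def)
  moreover have "e ` {0..t2} \<inter> e ` {t2..1} \<inter> (?B - {e t2}) = {}"
  proof -
    have "y = t2" if "x \<in> {0..t2}" "y \<in> {t2..1}" "e x = e y" for x y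
      using that t01 inj_onD[OF inj that(3)] by auto
    then show ?thesis by blast
  qed
  moreover have "e t1 \<in> e ` {0..t2} \<inter> (?B - {e t2})" "e t3 \<in> e ` {t2..1} \<inter> (?B - {e t2})"
    using t t01 inj by (auto simp: T_def dest: inj_onD)
  ultimately show False unfolding connected_closed by blast
qed

text \<open>The ends are joined by an arc inside \<open>K\<close>, which together with \<open>e\<close> forms a Jordan curve. Near a
  point of \<open>e\<close> off \<open>K\<close> there are points on both sides of the curve, and close enough to that point
  nothing of \<open>K\<close> separates them.\<close>

lemma arc_closing_cycle_separates:
  fixes K :: "complex set"
  assumes K: "compact K" and e: "arc e" and ends: "path_image e \<inter> K = {pathstart e, pathfinish e}"
    and path: "path_component K (pathstart e) (pathfinish e)"
  obtains a b where "connected_component (- K) a b"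
    "a \<notin> K \<union> path_image e" "b \<notin> K \<union> path_image e"
    "\<not> connected_component (- (K \<union> path_image e)) a b"
proof -
  let ?P = "path_image e" and ?p = "pathstart e" and ?q = "pathfinish e"
  have pq: "?q \<noteq> ?p" using e by (metis arc_distinct_ends)
  have "path_component K ?q ?p" using path path_component_sym by blast
  then obtain g0 where g0: "path g0" "path_image g0 \<subseteq> K" "pathstart g0 = ?q" "pathfinish g0 = ?p"
    by (auto simp: path_component_def)
  obtain g where g: "arc g" "path_image g \<subseteq> path_image g0" "pathstart g = ?q" "pathfinish g = ?p"
    using path_contains_arc[OF g0(1,3,4) pq] .
  have gK: "path_image g \<subseteq> K" using g g0 by blast
  let ?c = "e +++ g"
  have "?P \<inter> path_image g \<subseteq> {?p, ?q}" using gK ends by blast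
  then have c: "simple_path ?c" "pathfinish ?c = pathstart ?c"
    using simple_path_join_loop[OF e g(1)] g by auto
  have imc: "path_image ?c = ?P \<union> path_image g" using g by (simp add: path_image_join)
  have "\<not> ?P \<subseteq> K"
  proof
    assume "?P \<subseteq> K"
    then have "?P = {?p, ?q}" using ends by blast
    then have "finite ?P" by (metis finite.emptyI finite_insert)
    moreover have "connected ?P" using e by (simp add: arc_imp_path connected_path_image)
    ultimately have "?P = {} \<or> (\<exists>x. ?P = {x})" using connected_finite_iff_sing by blast
    then show False using pq by (metis empty_iff pathfinish_in_path_image pathstart_in_path_image singletonD)
  qed
  then obtain x where x: "x \<in> ?P" "x \<notin> K" by blast
  have "open (- K)" using K by (simp add: compact_imp_closed open_Compl)
  then obtain r where r: "0 < r" "ball x r \<subseteq> - K" using x open_contains_ball by blast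
  let ?B = "ball x r"
  note J = Jordan_inside_outside[OF c]
  have xfr: "x \<in> frontier (inside (path_image ?c))" "x \<in> frontier (outside (path_image ?c))"
    using J x imc by auto
  have xB: "x \<in> ?B" using r by simp
  obtain a where a: "a \<in> inside (path_image ?c)" "a \<in> ?B"
    using xfr(1) xB unfolding frontier_def by (metis DiffD1 closure_iff_nhds_not_empty disjoint_iff open_ball order_refl)
  obtain b where b: "b \<in> outside (path_image ?c)" "b \<in> ?B"
    using xfr(2) xB unfolding frontier_def by (metis DiffD1 closure_iff_nhds_not_empty disjoint_iff open_ball order_refl)
  have notc: "a \<notin> path_image ?c" "b \<notin> path_image ?c"
    using a b by (metis IntI empty_iff inside_no_overlap, metis IntI empty_iff outside_no_overlap)
  show thesis
  proof
    show "connected_component (- K) a b"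
      unfolding connected_component_def using a(2) b(2) r(2) by (intro exI[of _ ?B]) auto
    show "a \<notin> K \<union> ?P" "b \<notin> K \<union> ?P" using a(2) b(2) r(2) notc imc by auto
    show "\<not> connected_component (- (K \<union> ?P)) a b"
    proof
      assume "connected_component (- (K \<union> ?P)) a b"
      then have "connected_component (- path_image ?c) a b"
        by (rule connected_component_of_subset) (use imc gK in auto)
      then have "b \<in> inside (path_image ?c)" using a(1) inside_same_component by blast
      then show False using b(1) inside_Int_outside by blast
    qed
  qed
qed

lemma pendant_arc_keeps_connected:
  fixes K :: "complex set"
  assumes "closed K" "arc e" "path_image e \<inter> K \<subseteq> {x}" "connected (- K)"
  shows "connected (- (path_image e \<union> K))"
  unfolding connected_iff_connected_component
proof (intro ballI)
  fix a b assume ab: "a \<in> - (path_image e \<union> K)" "b \<in> - (path_image e \<union> K)"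
  show "connected_component (- (path_image e \<union> K)) a b"
  proof (rule Janiszewski)
    show "compact (path_image e)" using assms(2) by (simp add: compact_arc_image)
    have "path_image e \<inter> K = {} \<or> path_image e \<inter> K = {x}" using assms(3) by blast
    then show "connected (path_image e \<inter> K)" by (metis connected_empty connected_sing)
    show "connected_component (- path_image e) a b"
      using ab connected_arc_complement[OF assms(2)] by (auto simp: connected_iff_connected_component)
    show "connected_component (- K) a b"
      using ab assms(4) by (auto simp: connected_iff_connected_component)
  qed (rule assms(1))
qed

text \<open>A connected set that meets a region but avoids its frontier stays inside. This is how a face of
  the whole drawing is recognized as a component of the complement of a part of it.\<close>

lemma connected_component_in_region:
  assumes "connected_component (- Y) a z" "a \<in> f" "frontier f \<subseteq> Y"
  shows "z \<in> f"
proof (rule ccontr)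
  assume "z \<notin> f"
  obtain S where S: "connected S" "S \<subseteq> - Y" "a \<in> S" "z \<in> S"
    using assms(1) by (auto simp: connected_component_def)
  then have "S \<inter> frontier f \<noteq> {}"
    using connected_Int_frontier[OF S(1), of f] assms(2) \<open>z \<notin> f\<close> by blast
  then show False using S assms(3) by blast
qed

section \<open>Plane drawings\<close>

locale plane_graph =
  fixes G :: "'a ugraph" and p :: "'a \<Rightarrow> complex" and \<gamma> :: "'a set \<Rightarrow> real \<Rightarrow> complex"
  assumes simple: "simple_graph G" and drawing: "plane_drawing G p \<gamma>"
begin

text \<open>The part of the drawing made of some vertices and some edges. The two sets are independent of
  each other because the induction over forests removes a leaf together with its edge.\<close>

definition drawn :: "'a set \<Rightarrow> 'a set set \<Rightarrow> complex set" where
  "drawn U F = p ` U \<union> (\<Union>e\<in>F. path_image (\<gamma> e))"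

abbreviation faces :: "complex set set" where
  "faces \<equiv> components (- drawn (verts G) (edges G))"

definition open_edge :: "'a set \<Rightarrow> complex set" where
  "open_edge e = path_image (\<gamma> e) - p ` e"

text \<open>It is enough that a face accumulates at one inner point of an edge: the face then lies in the
  component, of the complement of all other edges, that contains the whole inner part of the edge.\<close>

definition border :: "complex set \<Rightarrow> 'a set set" where
  "border f = {e\<in>edges G. open_edge e \<inter> closure f \<noteq> {}}"

lemma finite_verts: "finite (verts G)" using simple by (simp add: simple_graph_def)

lemma edgeD: "e \<in> edges G \<Longrightarrow> card e = 2 \<and> e \<subseteq> verts G"
  using simple by (simp add: simple_graph_def)

lemma finite_edges: "finite (edges G)"
proof (rule finite_subset)
  show "edges G \<subseteq> Pow (verts G)" using edgeD by blast
qed (simp add: finite_verts)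

lemma inj_p: "inj_on p (verts G)" using drawing by (simp add: plane_drawing_def)

lemma edge_arc: "e \<in> edges G \<Longrightarrow> arc (\<gamma> e)"
  and edge_ends: "e \<in> edges G \<Longrightarrow> {pathstart (\<gamma> e), pathfinish (\<gamma> e)} = p ` e"
  and vertex_on_edge: "e \<in> edges G \<Longrightarrow> v \<in> verts G \<Longrightarrow> p v \<in> path_image (\<gamma> e) \<Longrightarrow> v \<in> e"
  and edges_meet: "e \<in> edges G \<Longrightarrow> f \<in> edges G \<Longrightarrow> e \<noteq> f \<Longrightarrow>
    path_image (\<gamma> e) \<inter> path_image (\<gamma> f) \<subseteq> p ` (e \<inter> f)"
  using drawing by (auto simp: plane_drawing_def)

lemma ends_in_edge: "e \<in> edges G \<Longrightarrow> p ` e \<subseteq> path_image (\<gamma> e)"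
  by (metis edge_ends empty_subsetI insert_subset pathfinish_in_path_image pathstart_in_path_image)

lemma compact_drawn:
  assumes "U \<subseteq> verts G" "F \<subseteq> edges G"
  shows "compact (drawn U F)"
proof -
  have "finite U" "finite F" using assms finite_verts finite_edges finite_subset by metis+
  moreover have "compact (path_image (\<gamma> e))" if "e \<in> F" for e
    using that assms(2) edge_arc compact_arc_image by blast
  ultimately show ?thesis
    unfolding drawn_def by (simp add: compact_Un compact_UN finite_imp_compact)
qed

lemma closed_drawn: "U \<subseteq> verts G \<Longrightarrow> F \<subseteq> edges G \<Longrightarrow> closed (drawn U F)"
  by (simp add: compact_drawn compact_imp_closed)

lemma drawn_mono: "U \<subseteq> U' \<Longrightarrow> F \<subseteq> F' \<Longrightarrow> drawn U F \<subseteq> drawn U' F'"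
  unfolding drawn_def by blast

lemma drawn_insert: "drawn U (insert e F) = drawn U F \<union> path_image (\<gamma> e)"
  unfolding drawn_def by blast

lemma edge_meets_drawn:
  assumes "e \<in> edges G" "F \<subseteq> edges G" "e \<notin> F" "U \<subseteq> verts G"
  shows "path_image (\<gamma> e) \<inter> drawn U F \<subseteq> p ` (e \<inter> (U \<union> \<Union>F))"
proof
  fix x assume "x \<in> path_image (\<gamma> e) \<inter> drawn U F"
  then consider v where "x = p v" "v \<in> U" "x \<in> path_image (\<gamma> e)"
    | f where "f \<in> F" "x \<in> path_image (\<gamma> e) \<inter> path_image (\<gamma> f)"
    unfolding drawn_def by blast
  then show "x \<in> p ` (e \<inter> (U \<union> \<Union>F))"
  proof cases
    case 1 then show ?thesis using vertex_on_edge[OF assms(1), of v] assms(4) by blast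
  next
    case 2
    then have "x \<in> p ` (e \<inter> f)" using edges_meet[OF assms(1), of f] assms(2,3) by blast
    then show ?thesis using 2 by blast
  qed
qed

text \<open>With all vertices drawn, both ends of the edge are on the drawing, as the splitting and closing
  lemmas for arcs require.\<close>

lemma edge_meets_spanning:
  assumes "e \<in> edges G" "F \<subseteq> edges G" "e \<notin> F"
  shows "path_image (\<gamma> e) \<inter> drawn (verts G) F = {pathstart (\<gamma> e), pathfinish (\<gamma> e)}"
proof
  show "path_image (\<gamma> e) \<inter> drawn (verts G) F \<subseteq> {pathstart (\<gamma> e), pathfinish (\<gamma> e)}"
    using edge_meets_drawn[OF assms order_refl] edge_ends[OF assms(1)] by blast
  have "p ` e \<subseteq> drawn (verts G) F" using edgeD[OF assms(1)] unfolding drawn_def by blast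
  then show "{pathstart (\<gamma> e), pathfinish (\<gamma> e)} \<subseteq> path_image (\<gamma> e) \<inter> drawn (verts G) F"
    using edge_ends[OF assms(1)] ends_in_edge[OF assms(1)] by blast
qed

lemma open_edge_disjoint:
  assumes "e \<in> edges G" "F \<subseteq> edges G" "e \<notin> F" "U \<subseteq> verts G"
  shows "open_edge e \<inter> drawn U F = {}"
  using edge_meets_drawn[OF assms] unfolding open_edge_def by blast

lemma open_edge_eq:
  assumes "e \<in> edges G"
  shows "open_edge e = \<gamma> e ` {0<..<1}"
proof -
  have inj: "inj_on (\<gamma> e) {0..1}" using edge_arc[OF assms] by (simp add: arc_def)
  have ends: "p ` e = \<gamma> e ` {0, 1}"
    using edge_ends[OF assms] by (simp add: pathstart_def pathfinish_def)
  have "\<gamma> e ` ({0..1} - {0, 1}) = \<gamma> e ` {0..1} - \<gamma> e ` {0, 1}"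
    by (rule inj_on_image_set_diff[OF inj]) auto
  moreover have "{0..1} - {0, 1} = {0<..<1::real}" by auto
  ultimately show ?thesis by (simp add: open_edge_def path_image_def ends)
qed

lemma open_edge_nonempty: "e \<in> edges G \<Longrightarrow> open_edge e \<noteq> {}"
  by (simp add: open_edge_eq)

lemma connected_open_edge:
  assumes "e \<in> edges G"
  shows "connected (open_edge e)"
  unfolding open_edge_eq[OF assms]
proof (rule connected_continuous_image)
  have "continuous_on {0..1} (\<gamma> e)" using edge_arc[OF assms] by (simp add: arc_def path_def)
  then show "continuous_on {0<..<1} (\<gamma> e)" by (rule continuous_on_subset) auto
qed simp

lemma end_in_closure_open_edge:
  assumes "e \<in> edges G" "v \<in> e"
  shows "p v \<in> closure (open_edge e)"
proof -
  have "continuous_on (closure {0<..<1}) (\<gamma> e)"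
    using edge_arc[OF assms(1)] by (simp add: arc_def path_def)
  then have "\<gamma> e ` closure {0<..<1} \<subseteq> closure (\<gamma> e ` {0<..<1})"
    by (rule image_closure_subset) (auto simp: closure_subset)
  then have "path_image (\<gamma> e) \<subseteq> closure (open_edge e)"
    by (simp add: path_image_def open_edge_eq[OF assms(1)])
  then show ?thesis using ends_in_edge[OF assms(1)] assms(2) by blast
qed

lemma face_nonempty: "f \<in> faces \<Longrightarrow> f \<noteq> {}"
  by (rule in_components_nonempty)

lemma face_disjoint: "f \<in> faces \<Longrightarrow> f \<inter> drawn (verts G) (edges G) = {}"
  using in_components_subset by blast

lemma frontier_face_subset: "f \<in> faces \<Longrightarrow> frontier f \<subseteq> drawn (verts G) (edges G)"
  by (rule frontier_of_components_closed_complement[OF closed_drawn]) simp_all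

text \<open>By definition, edges outside \<open>border f\<close> contribute at most their ends to the frontier.\<close>

lemma frontier_face:
  assumes "f \<in> faces"
  shows "frontier f \<subseteq> drawn (verts G) (border f)"
proof
  fix x assume x: "x \<in> frontier f"
  then have "x \<in> closure f" by (simp add: frontier_def)
  have "x \<in> drawn (verts G) (edges G)" using x frontier_face_subset[OF assms] by blast
  then consider "x \<in> p ` verts G" | e where "e \<in> edges G" "x \<in> path_image (\<gamma> e)"
    unfolding drawn_def by blast
  then show "x \<in> drawn (verts G) (border f)"
  proof cases
    case 1 then show ?thesis by (simp add: drawn_def)
  next
    case 2
    show ?thesis
    proof (cases "x \<in> p ` e")
      case True then show ?thesis using edgeD[OF 2(1)] unfolding drawn_def by blast
    next
      case False
      then have "e \<in> border f"
        using 2 \<open>x \<in> closure f\<close> unfolding border_def open_edge_def by blast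
      then show ?thesis using 2 unfolding drawn_def by blast
    qed
  qed
qed

text \<open>All faces bordered by \<open>e\<close> lie in one component of the complement of the other edges, and the arc
  of \<open>e\<close> cuts that component into at most two pieces.\<close>

lemma edge_borders_at_most_two:
  assumes e: "e \<in> edges G" and P: "P \<subseteq> faces" "finite P"
  shows "card {f\<in>P. e \<in> border f} \<le> 2"
proof (rule ccontr)
  assume "\<not> ?thesis"
  then have "3 \<le> card {f\<in>P. e \<in> border f}" by simp
  then obtain T where T: "T \<subseteq> {f\<in>P. e \<in> border f}" "card T = 3"
    using obtain_subset_with_card_n by metis
  obtain f1 f2 f3 where f: "T = {f1, f2, f3}" "f1 \<noteq> f2" "f2 \<noteq> f3" "f1 \<noteq> f3"
    using T(2) unfolding card_3_iff by blast
  define K where "K = drawn (verts G) (edges G - {e})"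
  have compK: "compact K" unfolding K_def by (rule compact_drawn) auto
  have all: "drawn (verts G) (edges G) = K \<union> path_image (\<gamma> e)"
    unfolding K_def using drawn_insert[of "verts G" e "edges G - {e}"] e by (simp add: insert_absorb)
  have eK: "open_edge e \<inter> K = {}" unfolding K_def by (rule open_edge_disjoint) (use e in auto)
  obtain x where x: "x \<in> open_edge e" using open_edge_nonempty[OF e] by blast
  have reach: "\<exists>a\<in>f. connected_component (- K) x a" if "f \<in> T" for f
  proof -
    have fP: "f \<in> faces" "e \<in> border f" using that T P by auto
    then obtain y where y: "y \<in> open_edge e" "y \<in> closure f" unfolding border_def by blast
    have "open (- K)" using compK by (simp add: compact_imp_closed open_Compl)
    moreover have "y \<in> - K" using y eK by blast
    ultimately obtain r where r: "0 < r" "ball y r \<subseteq> - K" using open_contains_ball by metis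
    obtain a where a: "a \<in> f" "a \<in> ball y r"
      using y(2) r(1) by (metis closure_approachable dist_commute mem_ball)
    have "connected_component (- K) x y"
      unfolding connected_component_def
      using connected_open_edge[OF e] x y eK by (intro exI[of _ "open_edge e"]) auto
    moreover have "connected_component (- K) y a"
      unfolding connected_component_def using r a by (intro exI[of _ "ball y r"]) auto
    ultimately show ?thesis using a connected_component_trans by blast
  qed
  obtain a1 a2 a3 where a: "a1 \<in> f1" "a2 \<in> f2" "a3 \<in> f3"
    "connected_component (- K) x a1" "connected_component (- K) x a2" "connected_component (- K) x a3"
    using reach f(1) by (metis insertCI)
  have faces: "f1 \<in> faces" "f2 \<in> faces" "f3 \<in> faces" using T P f by auto
  have out: "a1 \<notin> K \<union> path_image (\<gamma> e)" "a2 \<notin> K \<union> path_image (\<gamma> e)" "a3 \<notin> K \<union> path_image (\<gamma> e)"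
    using face_disjoint[OF faces(1)] face_disjoint[OF faces(2)] face_disjoint[OF faces(3)] a
    unfolding all by blast+
  have same: "f = f'" if "f \<in> faces" "f' \<in> faces" "u \<in> f" "v \<in> f'"
    "connected_component (- (K \<union> path_image (\<gamma> e))) u v" for f f' u v
  proof -
    have "v \<in> f"
      by (rule connected_component_in_region[OF that(5,3)])
        (use frontier_face_subset[OF that(1)] all in simp)
    then show ?thesis using components_nonoverlap[OF that(1,2)] that(4) by blast
  qed
  have meet: "path_image (\<gamma> e) \<inter> K = {pathstart (\<gamma> e), pathfinish (\<gamma> e)}"
    unfolding K_def by (rule edge_meets_spanning) (use e in auto)
  have "connected_component (- K) a1 a2" "connected_component (- K) a1 a3"
    using a(4-6) by (meson connected_component_sym connected_component_trans)+
  from arc_splits_in_at_most_two[OF compK edge_arc[OF e] meet out this] show False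
    using same[OF faces(1,2) a(1,2)] same[OF faces(1,3) a(1,3)] same[OF faces(2,3) a(2,3)] f by blast
qed

text \<open>By Janiszewski's theorem, attaching an arc at a single point does not separate. The set \<open>U\<close> varies
  because the leaf \<open>v\<close> must not be on the drawing before its edge is attached.\<close>

lemma forest_complement_connected:
  assumes "leaf_forest F" "F \<subseteq> edges G" "U \<subseteq> verts G"
  shows "connected (- drawn U F)"
  using assms
proof (induction arbitrary: U)
  case empty
  have "finite (p ` U)" using empty.prems finite_verts finite_subset by blast
  then have "connected (- p ` U)"
    by (intro path_connected_imp_connected path_connected_complement_countable)
      (auto intro: countable_finite)
  then show ?case by (simp add: drawn_def)
next
  case (attach F u v)
  let ?e = "{u, v}"
  have e: "?e \<in> edges G" and F: "F \<subseteq> edges G" using attach.prems by auto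
  have U: "U - {v} \<subseteq> verts G" using attach.prems by auto
  have "?e \<notin> F" using attach.hyps by auto
  then have "path_image (\<gamma> ?e) \<inter> drawn (U - {v}) F \<subseteq> p ` (?e \<inter> (U - {v} \<union> \<Union>F))"
    by (intro edge_meets_drawn e F U)
  also have "\<dots> \<subseteq> {p u}" using attach.hyps by auto
  finally have "connected (- (path_image (\<gamma> ?e) \<union> drawn (U - {v}) F))"
    using attach.IH[OF F U] by (intro pendant_arc_keeps_connected closed_drawn edge_arc e F U)
  moreover have "path_image (\<gamma> ?e) \<union> drawn (U - {v}) F = drawn U (insert ?e F)"
    using ends_in_edge[OF e] by (auto simp: drawn_def)
  ultimately show ?case by simp
qed

text \<open>The frontier of \<open>f\<close> lies on the part of the drawing made of \<open>border f\<close>. If that part does not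
  separate the plane, then \<open>f\<close> is its whole complement, and there is no room for other edges.\<close>

lemma border_contains_cycle:
  assumes "f \<in> faces" and nf: "\<not> leaf_forest (edges G)"
  shows "\<not> leaf_forest (border f)"
proof
  assume lf: "leaf_forest (border f)"
  let ?Y = "drawn (verts G) (border f)"
  have bE: "border f \<subseteq> edges G" by (auto simp: border_def)
  have conn: "connected (- ?Y)" by (rule forest_complement_connected[OF lf bE order_refl])
  obtain a where a: "a \<in> f" using face_nonempty[OF assms(1)] by blast
  have YX: "?Y \<subseteq> drawn (verts G) (edges G)" using bE by (intro drawn_mono) auto
  have "a \<in> - ?Y" using a YX face_disjoint[OF assms(1)] by blast
  then have f: "- ?Y \<subseteq> f"
    using conn connected_component_in_region[OF _ a frontier_face[OF assms(1)]]
    unfolding connected_iff_connected_component by blast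
  have "edges G \<subseteq> border f"
  proof (rule subsetI, rule ccontr)
    fix e assume e: "e \<in> edges G" "e \<notin> border f"
    obtain x where x: "x \<in> open_edge e" using open_edge_nonempty[OF e(1)] by blast
    then have "x \<notin> ?Y" using open_edge_disjoint[OF e(1) bE e(2) order_refl] by blast
    then have "x \<in> f" using f by blast
    moreover have "x \<in> drawn (verts G) (edges G)" using x e unfolding drawn_def open_edge_def by blast
    ultimately show False using face_disjoint[OF assms(1)] by blast
  qed
  then show False using lf nf bE by (metis subset_antisym)
qed

text \<open>The lower bound in Euler's formula. The induction keeps a labelling \<open>r\<close> of the vertices in which
  equal labels mean joined in the drawing so far. An edge between equal labels closes a cycle and
  creates a new face; an edge between different labels merges the two labels. The number of faces
  minus edges minus labels never drops, and at least one label remains. Counting through a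
  finite set \<open>P\<close> of faces avoids a proof that there are finitely many.\<close>

lemma many_faces:
  assumes ne: "verts G \<noteq> {}"
  obtains P where "P \<subseteq> faces" "finite P" "card (edges G) + 2 \<le> card P + card (verts G)"
proof -
  let ?V = "verts G"
  have "\<exists>P r. P \<subseteq> components (- drawn ?V F) \<and> finite P \<and>
      card F + 1 + card (r ` ?V) \<le> card P + card ?V \<and>
      (\<forall>u\<in>?V. \<forall>v\<in>?V. (r :: 'a \<Rightarrow> 'a) u = r v \<longrightarrow> path_component (drawn ?V F) (p u) (p v))"
    if "F \<subseteq> edges G" "finite F" for F
    using that(2,1)
  proof (induction F)
    case empty
    have "- drawn ?V {} \<noteq> {}"
      using compact_drawn[of ?V "{}"] by (metis compact_imp_bounded double_compl compl_bot_eq empty_subsetI not_bounded_UNIV order_refl)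
    then obtain C where "C \<in> components (- drawn ?V {})" by (metis all_not_in_conv components_eq_empty)
    then show ?case
      by (intro exI[of _ "{C}"] exI[of _ id]) (auto intro: path_component_refl simp: drawn_def)
  next
    case (insert e F)
    then have e: "e \<in> edges G" and F: "F \<subseteq> edges G" by auto
    let ?K = "drawn ?V F" and ?K' = "drawn ?V (insert e F)" and ?P = "path_image (\<gamma> e)"
    have K': "?K' = ?K \<union> ?P" by (rule drawn_insert)
    have compK: "compact ?K" by (rule compact_drawn[OF order_refl F])
    have meet: "?P \<inter> ?K = {pathstart (\<gamma> e), pathfinish (\<gamma> e)}"
      by (rule edge_meets_spanning[OF e F]) fact
    obtain P r where P: "P \<subseteq> components (- ?K)" "finite P"
      and card: "card F + 1 + card (r ` ?V) \<le> card P + card ?V"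
      and r: "\<And>u v. u \<in> ?V \<Longrightarrow> v \<in> ?V \<Longrightarrow> (r :: 'a \<Rightarrow> 'a) u = r v \<Longrightarrow> path_component ?K (p u) (p v)"
      using insert.IH[OF F] by blast
    have "\<exists>D. D \<in> components (- ?K') \<and> D \<subseteq> C" if "C \<in> P" for C
    proof -
      have C: "C \<in> components (- ?K)" using that P by blast
      have "open C" using C compK by (meson compact_imp_closed open_Compl open_components)
      then obtain x where x: "x \<in> C" "x \<notin> ?P"
        using path_image_arc_meets_complement[OF edge_arc[OF e]] in_components_nonempty[OF C] by blast
      then have xK': "x \<in> - ?K'" using in_components_subset[OF C] K' by blast
      have "connected_component_set (- ?K') x \<subseteq> C"
      proof (rule components_maximal[OF C])
        show "connected_component_set (- ?K') x \<subseteq> - ?K"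
          using connected_component_subset[of "- ?K'" x] K' by blast
        show "C \<inter> connected_component_set (- ?K') x \<noteq> {}" using x xK' by auto
      qed simp
      then show ?thesis using xK' by (blast intro: componentsI)
    qed
    \<comment> \<open>An arc cannot cover a face, so each old face leaves at least one new one.\<close>
    then obtain \<phi> where \<phi>: "\<And>C. C \<in> P \<Longrightarrow> \<phi> C \<in> components (- ?K')" "\<And>C. C \<in> P \<Longrightarrow> \<phi> C \<subseteq> C"
      by metis
    have disj: "C = D" if "C \<in> P" "D \<in> components (- ?K)" "x \<in> C" "x \<in> D" for C D x
      using components_nonoverlap[of C "- ?K" D] that P by blast
    have inj: "inj_on \<phi> P"
    proof (rule inj_onI)
      fix C D assume CD: "C \<in> P" "D \<in> P" "\<phi> C = \<phi> D"
      obtain x where "x \<in> \<phi> C" using in_components_nonempty[OF \<phi>(1)[OF CD(1)]] by blast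
      then show "C = D" using disj[of C D x] \<phi>(2) CD P by auto
    qed
    have img: "\<phi> ` P \<subseteq> components (- ?K')" "finite (\<phi> ` P)" "card (\<phi> ` P) = card P"
      using \<phi>(1) P(2) inj by (auto simp: card_image)
    have cardF: "card (insert e F) = card F + 1" using insert.hyps by simp
    obtain u v where uv: "e = {u, v}" "u \<in> ?V" "v \<in> ?V"
      using edgeD[OF e] by (auto simp: card_2_iff)
    have pe: "{p u, p v} = {pathstart (\<gamma> e), pathfinish (\<gamma> e)}" using edge_ends[OF e] uv by simp
    have mono: "path_component ?K' x y" if "path_component ?K x y" for x y
      using path_component_of_subset[OF _ that] K' by blast
    show ?case
    proof (cases "r u = r v")
      case True
      then have "path_component ?K (p u) (p v)" using r uv by blast
      then have "path_component ?K (pathstart (\<gamma> e)) (pathfinish (\<gamma> e))"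
        using pe by (metis doubleton_eq_iff path_component_sym)
      then obtain a b where ab: "connected_component (- ?K) a b" "a \<notin> ?K \<union> ?P" "b \<notin> ?K \<union> ?P"
        "\<not> connected_component (- (?K \<union> ?P)) a b"
        by (rule arc_closing_cycle_separates[OF compK edge_arc[OF e] meet])
      define A where "A = connected_component_set (- ?K') a"
      define B where "B = connected_component_set (- ?K') b"
      have comp: "A \<in> components (- ?K')" "B \<in> components (- ?K')"
        unfolding A_def B_def using ab K' by (auto intro: componentsI)
      have aA: "a \<in> A" "b \<in> B" unfolding A_def B_def using ab K' by auto
      have "A \<noteq> B" using ab(4) aA K' unfolding A_def by auto
      define C where "C = connected_component_set (- ?K) a"
      have C: "C \<in> components (- ?K)" unfolding C_def using ab by (auto intro: componentsI)
      have abC: "a \<in> C" "b \<in> C" using ab unfolding C_def by auto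
      have only: "D = C" if "D \<in> P" "\<phi> D = A \<or> \<phi> D = B" for D
        using that \<phi>(2)[of D] aA abC disj[OF that(1) C] by blast
      \<comment> \<open>Both \<open>A\<close> and \<open>B\<close> lie in the old face \<open>C\<close>, for which \<open>\<phi>\<close> has picked at most one of them.\<close>
      have "A \<notin> \<phi> ` P \<or> B \<notin> \<phi> ` P"
      proof (rule ccontr)
        assume "\<not> ?thesis"
        then obtain D D' where "D \<in> P" "D' \<in> P" "A = \<phi> D" "B = \<phi> D'" by blast
        then show False using only[of D] only[of D'] \<open>A \<noteq> B\<close> by simp
      qed
      then obtain N where N: "N \<in> components (- ?K')" "N \<notin> \<phi> ` P" using comp by blast
      have "card (insert N (\<phi> ` P)) = card P + 1" using N img by simp
      then show ?thesis
        using img N card cardF r mono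
        by (intro exI[of _ "insert N (\<phi> ` P)"] exI[of _ r]) auto
    next
      case False
      define r' where "r' x = (if r x = r u then r v else r x)" for x
      have "card (r' ` ?V) + 1 \<le> card (r ` ?V)"
      proof -
        have "r' ` ?V \<subseteq> r ` ?V - {r u}" using False uv by (auto simp: r'_def)
        then have "card (r' ` ?V) \<le> card (r ` ?V - {r u})" using finite_verts by (intro card_mono) auto
        moreover have "card (r ` ?V - {r u}) + 1 = card (r ` ?V)"
          using uv finite_verts by (metis Suc_eq_plus1 card_Suc_Diff1 finite_imageI imageI)
        ultimately show ?thesis by simp
      qed
      have "path_component ?K' (p u) (p v)"
      proof -
        have "path_component ?P (pathstart (\<gamma> e)) (pathfinish (\<gamma> e))"
          unfolding path_component_def using edge_arc[OF e] by (metis arc_imp_path order_refl)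
        then have "path_component ?K' (pathstart (\<gamma> e)) (pathfinish (\<gamma> e))"
          using K' path_component_of_subset by blast
        then show ?thesis using pe by (metis doubleton_eq_iff path_component_sym)
      qed
      then have "path_component ?K' (p x) (p y)" if "x \<in> ?V" "y \<in> ?V" "r' x = r' y" for x y
      proof -
        have join: "path_component ?K' (p x) (p y)" if "x \<in> ?V" "y \<in> ?V" "r x = r u" "r y = r v" for x y
          using mono[OF r[OF that(1) uv(2) that(3)]] \<open>path_component ?K' (p u) (p v)\<close>
            mono[OF r[OF uv(3) that(2)]] that(4) path_component_trans by metis
        show ?thesis
          using that mono r join[OF that(1,2)] path_component_sym[OF join[OF that(2,1)]]
          unfolding r'_def by (metis (full_types))
      qed
      then show ?thesis
        using img card cardF \<open>card (r' ` ?V) + 1 \<le> card (r ` ?V)\<close>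
        by (intro exI[of _ "\<phi> ` P"] exI[of _ r']) auto
    qed
  qed
  from this[OF order_refl finite_edges] obtain P and r :: "'a \<Rightarrow> 'a" where
    P: "P \<subseteq> faces" "finite P" "card (edges G) + 1 + card (r ` ?V) \<le> card P + card ?V"
    by blast
  moreover have "1 \<le> card (r ` ?V)" using ne finite_verts by (simp add: Suc_le_eq card_gt_0_iff)
  ultimately show thesis using that[of P] by linarith
qed

end

section \<open>Counting edges of plane graphs\<close>

lemma not_forest_card:
  assumes "finite F" "\<And>e. e \<in> F \<Longrightarrow> card e = 2" "\<not> leaf_forest F"
  shows "3 \<le> card F"
    and "(\<And>u v w. u \<noteq> v \<Longrightarrow> v \<noteq> w \<Longrightarrow> u \<noteq> w \<Longrightarrow> {u, v} \<in> F \<Longrightarrow> {v, w} \<in> F \<Longrightarrow> {u, w} \<notin> F) \<Longrightarrow>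
      4 \<le> card F"
proof -
  obtain J where J: "J \<subseteq> F" "J \<noteq> {}" "\<And>v. v \<in> \<Union>J \<Longrightarrow> \<not> card {e\<in>J. v \<in> e} < 2"
    using leaf_forestI[OF assms(1,2)] assms(3) by blast
  have le: "card J \<le> card F" by (rule card_mono[OF assms(1) J(1)])
  have finJ: "finite J" by (rule finite_subset[OF J(1) assms(1)])
  have J2: "card e = 2" if "e \<in> J" for e using that J(1) assms(2) by blast
  have deg: "2 \<le> card {e\<in>J. v \<in> e}" if "v \<in> \<Union>J" for v using J(3)[OF that] by simp
  note J3 = min_degree_two_card[OF finJ J(2) J2 deg]
  show "3 \<le> card F" using J3 le by linarith
  assume "\<And>u v w. u \<noteq> v \<Longrightarrow> v \<noteq> w \<Longrightarrow> u \<noteq> w \<Longrightarrow> {u, v} \<in> F \<Longrightarrow> {v, w} \<in> F \<Longrightarrow> {u, w} \<notin> F"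
  then have "card J \<noteq> 3" using J3 J(1) by (meson subsetD)
  then show "4 \<le> card F" using J3 le by linarith
qed

context plane_graph
begin

lemma sum_border:
  assumes "P \<subseteq> faces" "finite P"
  shows "(\<Sum>f\<in>P. card (border f)) \<le> 2 * card (edges G)"
proof -
  have "(\<Sum>f\<in>P. card (border f)) = (\<Sum>f\<in>P. card {e\<in>edges G. e \<in> border f})"
    by (rule sum.cong[OF refl]) (auto simp: border_def)
  also have "\<dots> = (\<Sum>e\<in>edges G. card {f\<in>P. e \<in> border f})"
    by (rule sum_multicount_gen[symmetric]) (use assms finite_edges in auto)
  also have "\<dots> \<le> (\<Sum>e\<in>edges G. 2)"
    by (rule sum_mono) (rule edge_borders_at_most_two[OF _ assms])
  finally show ?thesis by simp
qed

lemma forest_edge_bound: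
  assumes "leaf_forest (edges G)" "verts G \<noteq> {}"
  shows "card (edges G) < card (verts G)"
proof (cases "edges G = {}")
  case True
  then show ?thesis using assms finite_verts by (simp add: card_gt_0_iff)
next
  case False
  have "\<Union>(edges G) \<subseteq> verts G" using edgeD by blast
  then have "card (\<Union>(edges G)) \<le> card (verts G)" by (rule card_mono[OF finite_verts])
  then show ?thesis using leaf_forest_card[OF assms(1) False] by linarith
qed

text \<open>Here \<open>g\<close> plays the role of the girth. The double count reads
  \<open>g * (m - n + 2) \<le> g * card P \<le> 2 * m\<close> for \<open>m\<close> edges and \<open>n\<close> vertices.\<close>

lemma girth_edge_bound:
  assumes "verts G \<noteq> {}" "\<not> leaf_forest (edges G)"
    and g: "\<And>J. J \<subseteq> edges G \<Longrightarrow> \<not> leaf_forest J \<Longrightarrow> g \<le> card J"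
  shows "g * (card (edges G) + 2) \<le> 2 * card (edges G) + g * card (verts G)"
proof -
  obtain P where P: "P \<subseteq> faces" "finite P" "card (edges G) + 2 \<le> card P + card (verts G)"
    by (rule many_faces[OF assms(1)])
  have "g * card P = (\<Sum>f\<in>P. g)" by simp
  also have "\<dots> \<le> (\<Sum>f\<in>P. card (border f))"
  proof (rule sum_mono)
    fix f assume "f \<in> P"
    then show "g \<le> card (border f)"
      using P border_contains_cycle[OF _ assms(2)] by (intro g) (auto simp: border_def)
  qed
  also have "\<dots> \<le> 2 * card (edges G)" by (rule sum_border[OF P(1,2)])
  finally have "g * card P \<le> 2 * card (edges G)" .
  moreover have "g * (card (edges G) + 2) \<le> g * (card P + card (verts G))"
    using P(3) by (rule mult_le_mono2)
  ultimately show ?thesis by (simp add: add_mult_distrib2)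
qed

lemma planar_edge_bound:
  assumes "verts G \<noteq> {}"
  shows "card (edges G) \<le> 3 * (card (verts G) - 1)"
proof (cases "leaf_forest (edges G)")
  case True
  then show ?thesis using forest_edge_bound[OF True assms] by simp
next
  case False
  have *: "3 \<le> card J" if "J \<subseteq> edges G" "\<not> leaf_forest J" for J
    by (rule not_forest_card(1)[OF finite_subset[OF that(1) finite_edges] _ that(2)])
      (use that(1) edgeD in blast)
  have "3 * (card (edges G) + 2) \<le> 2 * card (edges G) + 3 * card (verts G)"
    by (rule girth_edge_bound[OF assms False]) (rule *)
  then show ?thesis by arith
qed

lemma triangle_free_edge_bound:
  assumes "verts G \<noteq> {}" "triangle_free G"
  shows "card (edges G) \<le> 2 * (card (verts G) - 1)"
proof (cases "leaf_forest (edges G)")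
  case True
  then show ?thesis using forest_edge_bound[OF True assms(1)] by simp
next
  case False
  have *: "4 \<le> card J" if "J \<subseteq> edges G" "\<not> leaf_forest J" for J
  proof (rule not_forest_card(2)[OF finite_subset[OF that(1) finite_edges] _ that(2)])
    show "card e = 2" if "e \<in> J" for e using that \<open>J \<subseteq> edges G\<close> edgeD by blast
    show "{u, w} \<notin> J" if "u \<noteq> v" "v \<noteq> w" "u \<noteq> w" "{u, v} \<in> J" "{v, w} \<in> J" for u v w
      using that \<open>J \<subseteq> edges G\<close> assms(2) unfolding triangle_free_def by blast
  qed
  have "4 * (card (edges G) + 2) \<le> 2 * card (edges G) + 4 * card (verts G)"
    by (rule girth_edge_bound[OF assms(1) False]) (rule *)
  then show ?thesis by arith
qed

text \<open>Suppose at most one edge at \<open>v\<close> borders \<open>f\<close>. Let \<open>S\<close> be this edge, or just the point of \<open>v\<close>, and \<open>Y\<close>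
  the rest of the border part of the drawing. A point of \<open>f\<close> and a point of a second edge \<open>h\<close>, both
  near \<open>v\<close>, are not separated by \<open>S\<close> nor by \<open>Y\<close>. As \<open>S\<close> and \<open>Y\<close> meet in at most one point,
  Janiszewski's theorem says that their union does not separate the two points either. But the union
  contains the frontier of \<open>f\<close>, so \<open>h\<close> would enter \<open>f\<close>.\<close>

lemma two_border_edges_at_vertex:
  assumes f: "f \<in> faces" and v: "v \<in> verts G" "p v \<in> closure f"
    and deg: "2 \<le> card {e\<in>edges G. v \<in> e}"
  shows "2 \<le> card {e\<in>border f. v \<in> e}"
proof (rule ccontr)
  assume "\<not> ?thesis"
  moreover have bE: "border f \<subseteq> edges G" by (auto simp: border_def)
  then have finb: "finite (border f)" using finite_edges finite_subset by blast
  ultimately have le1: "card {e\<in>border f. v \<in> e} \<le> Suc 0" by simp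
  let ?Bv = "{e\<in>border f. v \<in> e}" and ?Ev = "{e\<in>edges G. v \<in> e}"
  define U where "U = verts G - {v}"
  define Y where "Y = drawn U (border f - ?Bv)"
  define S where "S = insert (p v) (\<Union>e\<in>?Bv. path_image (\<gamma> e))"
  have all: "drawn (verts G) (border f) = S \<union> Y"
    using v(1) by (auto simp: drawn_def S_def Y_def U_def)
  have U: "U \<subseteq> verts G" by (auto simp: U_def)
  have clY: "closed Y" unfolding Y_def by (rule closed_drawn[OF U]) (use bE in blast)
  have pvY: "p v \<notin> Y"
  proof
    assume "p v \<in> Y"
    then consider u where "u \<in> U" "p v = p u"
      | e where "e \<in> border f - ?Bv" "p v \<in> path_image (\<gamma> e)"
      unfolding Y_def drawn_def by blast
    then show False
    proof cases
      case 1 then show ?thesis using inj_onD[OF inj_p 1(2) v(1)] by (auto simp: U_def)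
    next
      case 2 then show ?thesis using vertex_on_edge[OF _ v(1) 2(2)] bE by blast
    qed
  qed
  have S_props: "compact S \<and> connected (S \<inter> Y) \<and> connected (- S)"
  proof (cases "?Bv = {}")
    case True
    then have S: "S = {p v}" by (simp only: S_def) simp
    have "connected (- {p v})"
      unfolding Compl_eq_Diff_UNIV by (rule connected_open_delete) auto
    then show ?thesis using pvY by (simp add: S)
  next
    case False
    moreover have "finite ?Bv" using finb by simp
    ultimately have "card ?Bv \<noteq> 0" by (simp only: card_0_eq not_False_eq_True)
    then have "card ?Bv = Suc 0" using le1 by linarith
    then obtain e where Bv: "?Bv = {e}" unfolding card_1_singleton_iff by blast
    then have e: "e \<in> border f" "v \<in> e" by blast+
    then have eE: "e \<in> edges G" using bE by blast
    have S: "S = path_image (\<gamma> e)" unfolding S_def Bv using ends_in_edge[OF eE] e(2) by auto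
    obtain u where u: "e = {u, v}" using edgeD[OF eE] e(2) by (auto simp: card_2_iff)
    have "S \<inter> Y \<subseteq> p ` (e \<inter> (U \<union> \<Union>(border f - ?Bv)))"
      unfolding S Y_def by (rule edge_meets_drawn[OF eE _ _ U]) (use bE Bv in blast)+
    also have "\<dots> \<subseteq> {p u}" by (auto simp: u U_def)
    finally have "S \<inter> Y = {} \<or> S \<inter> Y = {p u}" by blast
    then have "connected (S \<inter> Y)" by (metis connected_empty connected_sing)
    then show ?thesis
      using edge_arc[OF eE] by (simp add: S compact_arc_image connected_arc_complement)
  qed
  have "\<not> ?Ev \<subseteq> ?Bv"
  proof
    assume "?Ev \<subseteq> ?Bv"
    then have "card ?Ev \<le> card ?Bv" using finb by (intro card_mono) auto
    then show False using le1 deg by linarith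
  qed
  then obtain h where h: "h \<in> edges G" "v \<in> h" "h \<notin> border f" by blast
  obtain r where r: "0 < r" "ball (p v) r \<subseteq> - Y"
    using clY pvY by (metis ComplI open_Compl open_contains_ball)
  obtain a where a: "a \<in> f" "a \<in> ball (p v) r"
    using v(2) r(1) by (metis closure_approachable dist_commute mem_ball)
  obtain z where z: "z \<in> open_edge h" "z \<in> ball (p v) r"
    using end_in_closure_open_edge[OF h(1,2)] r(1) by (metis closure_approachable dist_commute mem_ball)
  have zX: "z \<in> drawn (verts G) (edges G)" using z(1) h(1) unfolding drawn_def open_edge_def by blast
  have "z \<notin> S \<union> Y"
    using open_edge_disjoint[OF h(1) bE h(3) order_refl] z(1) unfolding all by blast
  moreover have "a \<notin> S \<union> Y"
    using face_disjoint[OF f] a(1) drawn_mono[OF order_refl bE, of "verts G"] unfolding all by blast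
  ultimately have "connected_component (- S) a z"
    using S_props by (auto simp: connected_iff_connected_component)
  moreover have "connected_component (- Y) a z"
    unfolding connected_component_def using r(2) a(2) z(2) by (intro exI[of _ "ball (p v) r"]) auto
  ultimately have "connected_component (- (S \<union> Y)) a z"
    using S_props clY by (intro Janiszewski) auto
  then have "z \<in> f"
    using connected_component_in_region[OF _ a(1)] frontier_face[OF f] unfolding all by blast
  then show False using zX face_disjoint[OF f] by blast
qed

end

lemma plane_graph_induced:
  assumes "plane_graph G p \<gamma>" "U \<subseteq> verts G"
  shows "plane_graph \<lparr>verts = U, edges = {e\<in>edges G. e \<subseteq> U}\<rparr> p \<gamma>"
proof -
  interpret plane_graph G p \<gamma> by fact
  show ?thesis
  proof
    show "simple_graph \<lparr>verts = U, edges = {e\<in>edges G. e \<subseteq> U}\<rparr>"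
      using edgeD finite_subset[OF assms(2) finite_verts] by (simp add: simple_graph_def)
    show "plane_drawing \<lparr>verts = U, edges = {e\<in>edges G. e \<subseteq> U}\<rparr> p \<gamma>"
      using drawing inj_on_subset[OF inj_p assms(2)] assms(2)
      unfolding plane_drawing_def by (simp add: subset_iff)
  qed
qed

text \<open>Outerplanarity is expressed through any connected set \<open>C\<close> off the drawing that reaches all
  vertices: unlike the outer face itself, the same \<open>C\<close> serves for every subgraph. If all degrees are
  at least 3 in a graph with \<open>n\<close> vertices and \<open>m\<close> edges, the face around \<open>C\<close> has at least \<open>n\<close> border edges and each other face at least 3, so
  \<open>3 * (m - n + 1) + n \<le> 2 * m\<close>.\<close>

lemma common_face_edge_bound:
  assumes "plane_graph G p \<gamma>" "verts G \<noteq> {}"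
    and C: "connected C" "C \<inter> drawing_points G p \<gamma> = {}" "p ` verts G \<subseteq> closure C"
  shows "card (edges G) \<le> 2 * (card (verts G) - 1)"
  using assms(1,2) C(2,3)
proof (induction "card (verts G)" arbitrary: G rule: less_induct)
  case less
  interpret plane_graph G p \<gamma> by (rule less.prems)
  have "C \<noteq> {}" using less.prems(2,4) by auto
  show ?case
  proof (cases "\<exists>v\<in>verts G. card {e\<in>edges G. v \<in> e} \<le> 2")
    case True
    then obtain v where v: "v \<in> verts G" "card {e\<in>edges G. v \<in> e} \<le> 2" by blast
    show ?thesis
    proof (cases "verts G = {v}")
      case True
      have "edges G = {}"
      proof (rule equals0I)
        fix e assume "e \<in> edges G"
        then have "card e = 2" "e \<subseteq> {v}" using edgeD True by auto
        then show False using card_mono[of "{v}" e] by simp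
      qed
      then show ?thesis by simp
    next
      case False
      let ?U = "verts G - {v}"
      let ?H = "\<lparr>verts = ?U, edges = {e\<in>edges G. e \<subseteq> ?U}\<rparr>"
      have card: "card ?U + 1 = card (verts G)" using v finite_verts by (metis Suc_eq_plus1 card_Suc_Diff1)
      have "card (edges ?H) \<le> 2 * (card (verts ?H) - 1)"
      proof (rule less.hyps)
        show "card (verts ?H) < card (verts G)" using card by simp
        show "plane_graph ?H p \<gamma>" by (rule plane_graph_induced[OF less.prems(1)]) auto
        show "verts ?H \<noteq> {}" using False v by auto
        show "C \<inter> drawing_points ?H p \<gamma> = {}"
          using less.prems(3) by (auto simp: drawing_points_def)
        show "p ` verts ?H \<subseteq> closure C" using less.prems(4) by auto
      qed
      moreover have "edges G \<subseteq> edges ?H \<union> {e\<in>edges G. v \<in> e}" using edgeD by auto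
      then have "card (edges G) \<le> card (edges ?H) + card {e\<in>edges G. v \<in> e}"
        using finite_edges by (intro order_trans[OF card_mono card_Un_le]) auto
      moreover have "card ?U \<noteq> 0"
      proof -
        have "?U \<noteq> {}" using False v(1) by blast
        then show ?thesis using finite_verts by (simp only: card_0_eq finite_Diff not_False_eq_True)
      qed
      ultimately show ?thesis using v(2) card by simp
    qed
  next
    case False
    then have deg: "3 \<le> card {e\<in>edges G. v \<in> e}" if "v \<in> verts G" for v using that by force
    have "\<not> leaf_forest (edges G)"
    proof
      assume lf: "leaf_forest (edges G)"
      have sub: "\<Union>(edges G) \<subseteq> verts G" using edgeD by blast
      have "verts G \<subseteq> \<Union>(edges G)"
      proof
        fix v assume "v \<in> verts G"
        then have "{e\<in>edges G. v \<in> e} \<noteq> {}" using deg[of v] by (metis card.empty not_numeral_le_zero)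
        then show "v \<in> \<Union>(edges G)" by blast
      qed
      then have V: "\<Union>(edges G) = verts G" using sub by blast
      have "(\<Sum>v\<in>verts G. 3) \<le> (\<Sum>v\<in>verts G. card {e\<in>edges G. v \<in> e})"
        by (rule sum_mono) (rule deg)
      also have "\<dots> = 2 * card (edges G)" using degree_sum[OF finite_edges] edgeD V by simp
      finally show False using forest_edge_bound[OF lf less.prems(2)] by simp
    qed
    have pts: "drawing_points G p \<gamma> = drawn (verts G) (edges G)"
      by (simp add: drawing_points_def drawn_def)
    obtain f where f: "f \<in> faces" "C \<subseteq> f"
    proof -
      have "C \<subseteq> - drawn (verts G) (edges G)" using less.prems(3) pts by blast
      then show thesis using exists_component_superset[OF _ _ C(1)] that \<open>C \<noteq> {}\<close> by blast
    qed
    have deg_f: "2 \<le> card {e\<in>border f. v \<in> e}" if "v \<in> verts G" for v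
    proof (rule two_border_edges_at_vertex[OF f(1) that])
      show "p v \<in> closure f" using less.prems(4) that closure_mono[OF f(2)] by blast
      show "2 \<le> card {e\<in>edges G. v \<in> e}" using deg[OF that] by linarith
    qed
    have bE: "border f \<subseteq> edges G" by (auto simp: border_def)
    have finb: "finite (border f)" by (rule finite_subset[OF bE finite_edges])
    have Vf: "\<Union>(border f) = verts G"
    proof
      show "\<Union>(border f) \<subseteq> verts G" using bE edgeD by blast
      show "verts G \<subseteq> \<Union>(border f)"
      proof
        fix v assume "v \<in> verts G"
        then have "{e\<in>border f. v \<in> e} \<noteq> {}" using deg_f[of v] by (metis card.empty not_numeral_le_zero)
        then show "v \<in> \<Union>(border f)" by blast
      qed
    qed
    have "(\<Sum>v\<in>verts G. 2) \<le> (\<Sum>v\<in>verts G. card {e\<in>border f. v \<in> e})"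
      by (rule sum_mono) (rule deg_f)
    also have "\<dots> = 2 * card (border f)"
      using degree_sum[OF finb] edgeD bE Vf by (simp add: subset_iff)
    finally have long: "card (verts G) \<le> card (border f)" by simp
    obtain P where P: "P \<subseteq> faces" "finite P" "card (edges G) + 2 \<le> card P + card (verts G)"
      by (rule many_faces[OF less.prems(2)])
    let ?P = "P - {f}"
    have "3 * card ?P + card (verts G) \<le> (\<Sum>h\<in>?P. card (border h)) + card (border f)"
    proof -
      have "3 \<le> card (border h)" if "h \<in> ?P" for h
      proof (rule not_forest_card(1))
        have bh: "border h \<subseteq> edges G" by (auto simp: border_def)
        show "finite (border h)" by (rule finite_subset[OF bh finite_edges])
        show "card e = 2" if "e \<in> border h" for e using that bh edgeD by blast
        show "\<not> leaf_forest (border h)"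
          by (rule border_contains_cycle) (use that P(1) \<open>\<not> leaf_forest (edges G)\<close> in auto)
      qed
      then have "(\<Sum>h\<in>?P. 3) \<le> (\<Sum>h\<in>?P. card (border h))" by (rule sum_mono)
      then show ?thesis using long by simp
    qed
    also have "\<dots> = (\<Sum>h\<in>insert f ?P. card (border h))"
      using P(2) by (simp del: insert_Diff_single)
    also have "\<dots> \<le> 2 * card (edges G)" by (rule sum_border) (use P f in auto)
    finally have "3 * card ?P + card (verts G) \<le> 2 * card (edges G)" .
    moreover have "card P \<le> card ?P + 1"
      using card_Suc_Diff1[OF P(2), of f] by (cases "f \<in> P") auto
    ultimately show ?thesis using P(3) by linarith
  qed
qed

section \<open>From forests to interval colorings\<close>

lemma leaf_forest_interval_coloring:
  assumes "leaf_forest F"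
  shows "\<exists>t c. (\<forall>e\<in>F. c e \<in> {1..t}) \<and>
    (\<forall>e\<in>F. \<forall>f\<in>F. e \<noteq> f \<and> e \<inter> f \<noteq> {} \<longrightarrow> c e \<noteq> c f) \<and>
    (\<forall>v. \<exists>a b. c ` {e\<in>F. v \<in> e} = {a..b :: nat})"
  using assms
proof induction
  case empty
  have "{} = {1..0::nat}" by simp
  then show ?case by (metis (no_types, lifting) empty_Collect_eq empty_iff image_empty)
next
  case (attach F u v)
  then obtain t and c :: "'a set \<Rightarrow> nat" where c: "\<And>e. e \<in> F \<Longrightarrow> c e \<in> {1..t}"
    and proper: "\<And>e f. e \<in> F \<Longrightarrow> f \<in> F \<Longrightarrow> e \<noteq> f \<Longrightarrow> e \<inter> f \<noteq> {} \<Longrightarrow> c e \<noteq> c f"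
    and interval: "\<And>v. \<exists>a b. c ` {e\<in>F. v \<in> e} = {a..b}"
    by metis
  let ?e = "{u, v}"
  have new: "?e \<notin> F" using attach.hyps by auto
  obtain a b where ab: "c ` {e\<in>F. u \<in> e} = {a..b}" using interval[of u] by blast
  \<comment> \<open>The interval at \<open>u\<close> is empty if \<open>u\<close> is new as well; then any positive color will do.\<close>
  define k where "k = (if a \<le> b then Suc b else 1)"
  define d where "d = c(?e := k)"
  have dF: "d e = c e" if "e \<in> F" for e using that new by (auto simp: d_def)
  have k: "k \<notin> {a..b}" "1 \<le> k" by (auto simp: k_def)
  have fresh: "c e \<noteq> k" if "e \<in> F" "e \<inter> ?e \<noteq> {}" for e
  proof -
    have "u \<in> e" using that attach.hyps by auto
    then have "c e \<in> {a..b}" using that ab by blast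
    then show ?thesis using k by metis
  qed
  have interval': "\<exists>a b. d ` {e\<in>insert ?e F. w \<in> e} = {a..b}" for w
  proof -
    consider "w = u" | "w = v" | "w \<noteq> u" "w \<noteq> v" by blast
    then show ?thesis
    proof cases
      case 1
      have "{e\<in>insert ?e F. w \<in> e} = insert ?e {e\<in>F. u \<in> e}" using 1 by auto
      moreover have "d ` {e\<in>F. u \<in> e} = c ` {e\<in>F. u \<in> e}" using dF by (intro image_cong) auto
      moreover have "d ?e = k" by (simp add: d_def)
      ultimately have "d ` {e\<in>insert ?e F. w \<in> e} = insert k (c ` {e\<in>F. u \<in> e})" by simp
      also have "\<dots> = {(if a \<le> b then a else 1)..k}" unfolding ab k_def by auto
      finally show ?thesis by blast
    next
      case 2
      have "{e\<in>insert ?e F. w \<in> e} = {?e}" using 2 attach.hyps by auto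
      then have "d ` {e\<in>insert ?e F. w \<in> e} = {k..k}" by (simp add: d_def)
      then show ?thesis by blast
    next
      case 3
      then have "{e\<in>insert ?e F. w \<in> e} = {e\<in>F. w \<in> e}" by auto
      moreover have "d ` {e\<in>F. w \<in> e} = c ` {e\<in>F. w \<in> e}" using dF by (intro image_cong) auto
      ultimately show ?thesis using interval[of w] by simp
    qed
  qed
  have range: "d e \<in> {1..max t k}" if "e \<in> insert ?e F" for e
  proof (cases "e = ?e")
    case True then show ?thesis using k by (simp add: d_def)
  next
    case False then show ?thesis using that c[of e] dF[of e] by (simp add: le_max_iff_disj)
  qed
  have proper': "d e \<noteq> d f" if "e \<in> insert ?e F" "f \<in> insert ?e F" "e \<noteq> f" "e \<inter> f \<noteq> {}" for e f
  proof (cases "e = ?e")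
    case True
    then have f: "f \<in> F" using that by blast
    then have "d f = c f" "c f \<noteq> k" using dF fresh[of f] that True by (auto simp: Int_commute)
    then show ?thesis using True by (simp add: d_def)
  next
    case False
    then have e: "e \<in> F" using that by blast
    show ?thesis
    proof (cases "f = ?e")
      case True
      have "d e = c e" "c e \<noteq> k" using dF fresh[of e] that True e by auto
      then show ?thesis using True by (simp add: d_def)
    next
      case f: False
      then show ?thesis using that e dF proper[of e f] by auto
    qed
  qed
  show ?case
  proof (rule exI[of _ "max t k"], rule exI[of _ d], intro conjI ballI allI impI)
    fix e f assume "e \<in> insert ?e F" "f \<in> insert ?e F" "e \<noteq> f \<and> e \<inter> f \<noteq> {}"
    then show "d e \<noteq> d f" using proper'[of e f] by simp
  qed (rule range interval'; assumption?)+
qed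

lemma forest_interval_colorable:
  assumes "leaf_forest (edges H)"
  shows "interval_colorable H"
proof -
  obtain t c where "(\<forall>e\<in>edges H. c e \<in> {1..t}) \<and>
    (\<forall>e\<in>edges H. \<forall>f\<in>edges H. e \<noteq> f \<and> e \<inter> f \<noteq> {} \<longrightarrow> c e \<noteq> c f) \<and>
    (\<forall>v. \<exists>a b. c ` {e\<in>edges H. v \<in> e} = {a..b :: nat})"
    using leaf_forest_interval_coloring[OF assms] by (elim exE) (rule that)
  then have "interval_coloring H t c"
    unfolding interval_coloring_def proper_edge_coloring_def incident_edges_def
    by (elim conjE, intro conjI) (assumption | intro ballI, erule spec)+
  then show ?thesis unfolding interval_colorable_def by (intro exI)
qed

lemma interval_thickness_le_density:
  assumes G: "simple_graph G" and k: "0 < k"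
    and dens: "\<And>U. U \<subseteq> verts G \<Longrightarrow> U \<noteq> {} \<Longrightarrow> card {e\<in>edges G. e \<subseteq> U} \<le> k * (card U - 1)"
  shows "interval_thickness G \<le> k"
proof -
  have V: "finite (verts G)" and E: "\<And>e. e \<in> edges G \<Longrightarrow> card e = 2 \<and> e \<subseteq> verts G"
    using G by (auto simp: simple_graph_def)
  obtain c where c: "\<forall>e\<in>edges G. c e < k" "\<And>i. i < k \<Longrightarrow> leaf_forest {e\<in>edges G. c e = i}"
    using nash_williams[OF V E dens] by blast
  define H where "H i = \<lparr>verts = verts G, edges = {e\<in>edges G. c e = i}\<rparr>" for i
  let ?Hs = "map H [0..<k]"
  have "interval_decomposition G ?Hs"
    unfolding interval_decomposition_def
  proof (intro conjI ballI)
    fix X assume "X \<in> set ?Hs"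
    then obtain i where i: "i < k" "X = H i" by auto
    show "subgraph X G" using V E i by (auto simp: subgraph_def simple_graph_def H_def)
    show "interval_colorable X"
      by (rule forest_interval_colorable) (simp add: i(2) H_def c(2)[OF i(1)])
  next
    fix e assume "e \<in> edges G"
    then show "\<exists>!i. i < length ?Hs \<and> e \<in> edges (?Hs ! i)"
      using c(1) by (intro ex1I[of _ "c e"]) (auto simp: H_def)
  qed
  then show ?thesis
    unfolding interval_thickness_def using k by (intro Least_le) (metis length_map length_upt minus_nat.diff_0)
qed

lemma edges_within_le:
  assumes "simple_graph G" "U \<subseteq> verts G"
  shows "2 * card {e\<in>edges G. e \<subseteq> U} \<le> card U * (card U - 1)"
proof -
  have finU: "finite U" using assms by (auto simp: simple_graph_def intro: finite_subset)
  have "{e\<in>edges G. e \<subseteq> U} \<subseteq> {e. e \<subseteq> U \<and> card e = 2}" using assms by (auto simp: simple_graph_def)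
  then have "card {e\<in>edges G. e \<subseteq> U} \<le> card {e. e \<subseteq> U \<and> card e = 2}"
    by (rule card_mono[rotated]) (use finU in auto)
  also have "\<dots> = card U * (card U - 1) div 2" using n_subsets[OF finU, of 2] by (simp add: choose_two)
  finally show ?thesis by linarith
qed

theorem proposition3p15:
  fixes G :: "'a ugraph"
  assumes "simple_graph G"
  shows "(edges G \<noteq> {} \<longrightarrow>
            int (interval_thickness G) \<le> \<lceil>sqrt (real (card (edges G)) / 2)\<rceil>) \<and>
         (planar G \<longrightarrow> interval_thickness G \<le> 3) \<and>
         (planar G \<and> (triangle_free G \<or> outerplanar G) \<longrightarrow> interval_thickness G \<le> 2)"
proof (intro conjI impI)
  let ?q = "card (edges G)"
  assume ne: "edges G \<noteq> {}"
  have finE: "finite (edges G)"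
  proof (rule finite_subset)
    show "edges G \<subseteq> Pow (verts G)" using assms by (auto simp: simple_graph_def)
    show "finite (Pow (verts G))" using assms by (simp add: simple_graph_def)
  qed
  define k where "k = nat \<lceil>sqrt (real ?q / 2)\<rceil>"
  have pos: "0 < sqrt (real ?q / 2)" using ne finE by (simp add: card_gt_0_iff)
  then have "0 < \<lceil>sqrt (real ?q / 2)\<rceil>" by (rule zero_less_ceiling[THEN iffD2])
  then have k: "0 < k" "int k = \<lceil>sqrt (real ?q / 2)\<rceil>" unfolding k_def by linarith+
  have "sqrt (real ?q / 2) \<le> real k" using k(2) by (metis le_of_int_ceiling of_int_of_nat_eq)
  then have "real ?q / 2 \<le> (real k)\<^sup>2" using sqrt_le_D by blast
  then have "real ?q \<le> real (2 * k\<^sup>2)" by simp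
  then have q: "?q \<le> 2 * k\<^sup>2" by (simp only: of_nat_le_iff)
  have "interval_thickness G \<le> k"
  proof (rule interval_thickness_le_density[OF assms k(1)])
    fix U assume U: "U \<subseteq> verts G"
    show "card {e\<in>edges G. e \<subseteq> U} \<le> k * (card U - 1)"
    proof (cases "card U \<le> 2 * k")
      case True
      then have "card U * (card U - 1) \<le> 2 * k * (card U - 1)" by (rule mult_le_mono1)
      with edges_within_le[OF assms U] have "2 * card {e\<in>edges G. e \<subseteq> U} \<le> 2 * k * (card U - 1)"
        by (rule order_trans)
      then show ?thesis by (simp add: mult.assoc)
    next
      case False
      have "card {e\<in>edges G. e \<subseteq> U} \<le> ?q" using finE by (intro card_mono) auto
      also have "\<dots> \<le> k * (2 * k)" using q by (simp add: power2_eq_square)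
      also have "\<dots> \<le> k * (card U - 1)" using False by (intro mult_le_mono2) simp
      finally show ?thesis .
    qed
  qed
  then show "int (interval_thickness G) \<le> \<lceil>sqrt (real ?q / 2)\<rceil>" using k(2) by linarith
next
  assume "planar G"
  then obtain p \<gamma> where "plane_drawing G p \<gamma>" by (auto simp: planar_def)
  then have pg: "plane_graph G p \<gamma>" using assms by (simp add: plane_graph_def)
  show "interval_thickness G \<le> 3"
  proof (rule interval_thickness_le_density[OF assms])
    fix U assume U: "U \<subseteq> verts G" "U \<noteq> {}"
    show "card {e\<in>edges G. e \<subseteq> U} \<le> 3 * (card U - 1)"
      using plane_graph.planar_edge_bound[OF plane_graph_induced[OF pg U(1)]] U(2) by simp
  qed simp
next
  assume "planar G \<and> (triangle_free G \<or> outerplanar G)"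
  then consider p \<gamma> where "plane_drawing G p \<gamma>" "triangle_free G"
    | p \<gamma> where "plane_drawing G p \<gamma>" "p ` verts G \<subseteq> frontier (outside (drawing_points G p \<gamma>))"
    unfolding planar_def outerplanar_def by blast
  then show "interval_thickness G \<le> 2"
  proof cases
    case 1
    then have pg: "plane_graph G p \<gamma>" using assms by (simp add: plane_graph_def)
    show ?thesis
    proof (rule interval_thickness_le_density[OF assms])
      fix U assume U: "U \<subseteq> verts G" "U \<noteq> {}"
      have "triangle_free \<lparr>verts = U, edges = {e\<in>edges G. e \<subseteq> U}\<rparr>"
        using 1(2) by (simp add: triangle_free_def) blast
      then show "card {e\<in>edges G. e \<subseteq> U} \<le> 2 * (card U - 1)"
        using plane_graph.triangle_free_edge_bound[OF plane_graph_induced[OF pg U(1)]] U by simp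
    qed simp
  next
    case 2
    then have pg: "plane_graph G p \<gamma>" using assms by (simp add: plane_graph_def)
    then interpret plane_graph G p \<gamma> .
    let ?C = "outside (drawing_points G p \<gamma>)"
    have "compact (drawing_points G p \<gamma>)"
      using compact_drawn[OF order_refl order_refl] by (simp add: drawing_points_def drawn_def)
    then have conn: "connected ?C" by (intro connected_outside) (auto simp: compact_imp_bounded)
    show ?thesis
    proof (rule interval_thickness_le_density[OF assms])
      fix U assume U: "U \<subseteq> verts G" "U \<noteq> {}"
      let ?H = "\<lparr>verts = U, edges = {e\<in>edges G. e \<subseteq> U}\<rparr>"
      have "drawing_points ?H p \<gamma> \<subseteq> drawing_points G p \<gamma>"
        using U(1) by (auto simp: drawing_points_def)
      then have disj: "?C \<inter> drawing_points ?H p \<gamma> = {}" using outside_no_overlap by blast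
      have "p ` U \<subseteq> frontier ?C" using image_mono[OF U(1), of p] 2(2) by (rule order_trans)
      also have "\<dots> \<subseteq> closure ?C" unfolding frontier_def by (rule Diff_subset)
      finally have "p ` verts ?H \<subseteq> closure ?C" by simp
      from common_face_edge_bound[OF plane_graph_induced[OF pg U(1)] _ conn disj this]
      show "card {e\<in>edges G. e \<subseteq> U} \<le> 2 * (card U - 1)" using U(2) by simp
    qed simp
  qed
qed

end
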